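(* Let $p\in(0,1)$ and $\alpha>0$ be constants. Then there exist constants $c>0$ and $n_0$ (depending on $p$ and $\alpha$) such that for all $n\ge n_0$, \[\Pr_{G\sim G(n,p)}[G \text{ is not even-degenerate}]\le e^{-c\,n^{1/2-\alpha}}.\]
   Context: $G(n,p)$ is the Erdős–Rényi random graph on $n$ vertices in which each pair of vertices is an edge independently with probability $p$. A graph $G$ on $n$ vertices is even-degenerate if there is an ordering $v_1,\dots,v_n$ of its vertices such that for every $1\le i\le n-2$, $v_i$ has an even number of neighbours in $\{v_{i+1},\dots,v_n\}$. (The paper writes the conclusion as $e^{-\Omega(n^{1/2-\alpha})}$.) *)

theory Defs
  imports "HOL-Probability.Probability" "HOL-Probability.Product_PMF" "HOL-Library.Ramsey"
begin

text \<open>A simple graph is given by a finite vertex set \<open>V\<close> and a set \<open>E\<close> of two-element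
  subsets of \<open>V\<close>, so \<open>u\<close> and \<open>w\<close> are adjacent iff \<open>{u, w} \<in> E\<close>; \<open>nsets V 2\<close> is the
  set of all pairs of vertices.\<close>

definition erdos_renyi :: "nat \<Rightarrow> real \<Rightarrow> nat set set pmf" where
  "erdos_renyi n p =
     map_pmf (\<lambda>f. {e \<in> nsets {..<n} 2. f e})
       (Pi_pmf (nsets {..<n} 2) False (\<lambda>_. bernoulli_pmf p))"

text \<open>The ordering \<open>v 1, \<dots>, v n\<close> lists every vertex exactly once, and its last two vertices
  are unconstrained.\<close>

definition even_degenerate :: "'a set \<Rightarrow> 'a set set \<Rightarrow> bool" where
  "even_degenerate V E \<longleftrightarrow>
     (\<exists>v. bij_betw v {1..card V} V \<and>
       (\<forall>i. 1 \<le> i \<and> i + 2 \<le> card V \<longrightarrow>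
          even (card {u \<in> v ` {i + 1..card V}. {v i, u} \<in> E})))"

end

theory Submission
  imports Defs "HOL-Real_Asymp.Real_Asymp"
begin

text \<open>Read backwards, an admissible ordering builds the graph up from an arbitrary pair
  \<open>{a, b}\<close>, each new vertex having an even number of neighbours among those already present.
  Every step preserves the parity of the number of edges, so \<open>{a, b}\<close> must be an edge exactly
  when the graph has an odd number of edges. Fix such a pair, a vertex \<open>r\<close> and a set \<open>J\<close> of about
  \<open>sqrt n\<close> vertices.

  The remaining vertices \<open>q\<close> are swept through in a fixed order. If \<open>q\<close> can currently be added at
  the bottom (next to \<open>a, b\<close> and the earlier bottom vertices \<open>P\<close>) and also removed at the top (its
  degree after deleting the earlier top vertices \<open>Q\<close> is even), then a free choice bit \<open>w\<close> decides
  whether \<open>q\<close> joins \<open>P\<close> or \<open>Q\<close>; otherwise \<open>q\<close> is left in the middle. The edges \<open>{q, r}\<close> are made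
  uniform by a mixture decomposition of the Bernoulli distribution; they act as one-time pads, so
  that the degree parities are uniform and independent of all other edges. The vertex \<open>r\<close> is put
  last in the middle, where its condition holds automatically by parity.

  If the vertices of \<open>J\<close> could be used freely, the middle could be ordered greedily with failure
  probability exponentially small in \<open>card J\<close>: one inserts any other vertex that is ready, and a
  vertex of \<open>J\<close> only if there is none, which rerandomizes all bits. Such an order prescribes a
  parity vector in \<open>{0,1}^J\<close>, which the bottom \<open>P\<close> must hit. For two independent choices \<open>w, w'\<close>
  the vertices of \<open>P\<^sub>w \<inter> Q\<^sub>w\<^sub>'\<close> decorrelate the two hitting events, because their edges to \<open>J\<close>
  influence only the first one. There are linearly many such vertices up to exponentially small
  probability, whence a second moment argument over \<open>w\<close> shows that some choice works.\<close>

section \<open>Expectation over a random subset of a finite set\<close>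

text \<open>An explicit finite sum rather than an integral, so that splitting, exchanging and
  averaging are manipulations of sums. The probability may vary with the element, as the mixture
  decomposition requires.\<close>

definition rexp :: "'a set \<Rightarrow> ('a \<Rightarrow> real) \<Rightarrow> ('a set \<Rightarrow> real) \<Rightarrow> real" where
  "rexp F p g = (\<Sum>E\<in>Pow F. (\<Prod>e\<in>E. p e) * (\<Prod>e\<in>F - E. 1 - p e) * g E)"

lemma rexp_empty [simp]: "rexp {} p g = g {}"
  by (simp add: rexp_def)

lemma rexp_cong:
  assumes "F = F'" "\<And>e. e \<in> F' \<Longrightarrow> p e = p' e" "\<And>E. E \<subseteq> F' \<Longrightarrow> g E = g' E"
  shows "rexp F p g = rexp F' p' g'"
  unfolding rexp_def using assms
  by (intro sum.cong refl arg_cong2[where f = "(*)"] prod.cong) auto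

lemma rexp_insert:
  assumes F: "finite F" and x: "x \<notin> F"
  shows "rexp (insert x F) p g = p x * rexp F p (\<lambda>E. g (insert x E)) + (1 - p x) * rexp F p g"
proof -
  let ?w = "\<lambda>G E. (\<Prod>e\<in>E. p e) * (\<Prod>e\<in>G - E. 1 - p e)"
  have inj: "inj_on (insert x) (Pow F)"
    using x by (auto simp: inj_on_def)
  have w1: "?w (insert x F) (insert x E) = p x * ?w F E" if "E \<subseteq> F" for E
  proof -
    have "insert x F - insert x E = F - E" using x by auto
    moreover have "finite E" "x \<notin> E" using that x F finite_subset by auto
    ultimately show ?thesis by simp
  qed
  have w2: "?w (insert x F) E = (1 - p x) * ?w F E" if "E \<subseteq> F" for E
  proof -
    have "insert x F - E = insert x (F - E)" using x that by auto
    then show ?thesis using F x by simp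
  qed
  have "rexp (insert x F) p g
      = (\<Sum>E\<in>Pow F. ?w (insert x F) E * g E) + (\<Sum>E\<in>insert x ` Pow F. ?w (insert x F) E * g E)"
    unfolding rexp_def Pow_insert using F x by (intro sum.union_disjoint) auto
  also have "(\<Sum>E\<in>insert x ` Pow F. ?w (insert x F) E * g E)
      = (\<Sum>E\<in>Pow F. p x * (?w F E * g (insert x E)))"
    unfolding sum.reindex[OF inj] using w1 by (intro sum.cong) (auto simp: mult_ac)
  also have "(\<Sum>E\<in>Pow F. ?w (insert x F) E * g E) = (\<Sum>E\<in>Pow F. (1 - p x) * (?w F E * g E))"
    using w2 by (intro sum.cong) (auto simp: mult_ac)
  finally show ?thesis by (simp add: rexp_def sum_distrib_left)
qed

lemma rexp_add: "rexp F p (\<lambda>E. g E + h E) = rexp F p g + rexp F p h"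
  by (simp add: rexp_def distrib_left sum.distrib)

lemma rexp_cmult: "rexp F p (\<lambda>E. c * g E) = c * rexp F p g"
  unfolding rexp_def sum_distrib_left by (intro sum.cong) auto

lemma rexp_multc: "rexp F p (\<lambda>E. g E * c) = rexp F p g * c"
  unfolding rexp_def sum_distrib_right by (intro sum.cong) auto

lemma rexp_diff: "rexp F p (\<lambda>E. g E - h E) = rexp F p g - rexp F p h"
  by (simp add: rexp_def right_diff_distrib sum_subtractf)

lemma rexp_sum: "rexp F p (\<lambda>E. \<Sum>i\<in>I. g i E) = (\<Sum>i\<in>I. rexp F p (g i))"
  unfolding rexp_def sum_distrib_left by (rule sum.swap)

lemma rexp_const [simp]:
  assumes "finite F"
  shows "rexp F p (\<lambda>_. c) = c"
  using assms by (induction F) (simp_all add: rexp_insert algebra_simps)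

lemma rexp_swap:
  "rexp A p (\<lambda>E. rexp B q (\<lambda>E'. g E E')) = rexp B q (\<lambda>E'. rexp A p (\<lambda>E. g E E'))"
  unfolding rexp_def sum_distrib_left
  by (subst sum.swap) (simp add: mult_ac)

lemma rexp_mono:
  assumes "\<And>e. e \<in> F \<Longrightarrow> 0 \<le> p e \<and> p e \<le> 1" "\<And>E. E \<subseteq> F \<Longrightarrow> g E \<le> h E"
  shows "rexp F p g \<le> rexp F p h"
  unfolding rexp_def using assms
  by (intro sum_mono mult_left_mono mult_nonneg_nonneg prod_nonneg) auto

lemma rexp_nonneg:
  assumes "\<And>e. e \<in> F \<Longrightarrow> 0 \<le> p e \<and> p e \<le> 1" "\<And>E. E \<subseteq> F \<Longrightarrow> 0 \<le> g E"
  shows "0 \<le> rexp F p g"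
  unfolding rexp_def using assms
  by (intro sum_nonneg mult_nonneg_nonneg prod_nonneg) auto

lemma rexp_le:
  assumes "finite F" "\<And>e. e \<in> F \<Longrightarrow> 0 \<le> p e \<and> p e \<le> 1" "\<And>E. E \<subseteq> F \<Longrightarrow> g E \<le> c"
  shows "rexp F p g \<le> c"
  using rexp_mono[of F p g "\<lambda>_. c"] assms by simp

text \<open>Independence over disjoint sets, as an iterated expectation. Every staged exposure of
  edges goes through this.\<close>

lemma rexp_Un:
  assumes "finite A" "finite B" "A \<inter> B = {}"
  shows "rexp (A \<union> B) p g = rexp A p (\<lambda>E. rexp B p (\<lambda>E'. g (E \<union> E')))"
  using assms
proof (induction A arbitrary: g)
  case (insert x A)
  then have "rexp (insert x A \<union> B) p g
      = p x * rexp (A \<union> B) p (\<lambda>E. g (insert x E)) + (1 - p x) * rexp (A \<union> B) p g"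
    by (simp add: rexp_insert)
  with insert show ?case by (simp add: rexp_insert)
qed simp

lemma rexp_restrict:
  assumes "finite F" "A \<subseteq> F"
  shows "rexp F p (\<lambda>E. g (E \<inter> A)) = rexp A p g"
proof -
  have "rexp F p (\<lambda>E. g (E \<inter> A)) = rexp (A \<union> (F - A)) p (\<lambda>E. g (E \<inter> A))"
    using assms by (intro rexp_cong) auto
  also have "\<dots> = rexp A p (\<lambda>E. rexp (F - A) p (\<lambda>E'. g ((E \<union> E') \<inter> A)))"
    using assms finite_subset by (intro rexp_Un) auto
  also have "\<dots> = rexp A p (\<lambda>E. rexp (F - A) p (\<lambda>E'. g E))"
    by (intro rexp_cong refl arg_cong[where f = g]) auto
  finally show ?thesis using assms by simp
qed

lemma rexp_image:
  assumes "finite X" "inj_on f X"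
  shows "rexp (f ` X) p g = rexp X (\<lambda>x. p (f x)) (\<lambda>N. g (f ` N))"
  using assms
proof (induction X arbitrary: g)
  case (insert x X)
  then have "f x \<notin> f ` X" by auto
  with insert show ?case by (simp add: rexp_insert)
qed simp

section \<open>Uniform bits and mixtures of product measures\<close>

text \<open>At probability 1/2 all subsets have the same weight, and the symmetric difference with
  \<open>C\<close> is an involution on them. This is the one-time pad: a uniform set masks any fixed
  set.\<close>

lemma rexp_flip:
  assumes "finite Q" "C \<subseteq> Q"
  shows "rexp Q (\<lambda>_. 1/2) (\<lambda>N. g (sym_diff N C)) = rexp Q (\<lambda>_. 1/2) g"
proof -
  have w: "(\<Prod>e\<in>N. 1/2::real) * (\<Prod>e\<in>Q - N. 1 - 1/2) = (1/2) ^ card Q" if "N \<subseteq> Q" for N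
    using that assms(1) by (simp add: card_Diff_subset card_mono finite_subset flip: power_add)
  have "(\<Sum>N\<in>Pow Q. g (sym_diff N C)) = (\<Sum>N\<in>Pow Q. g N)"
    using assms by (intro sum.reindex_bij_witness[of _ "\<lambda>N. sym_diff N C" "\<lambda>N. sym_diff N C"]) auto
  then show ?thesis
    unfolding rexp_def using w by (simp add: sum_distrib_left[symmetric])
qed

text \<open>Each element first tosses a coin of bias \<open>m\<close> to decide whether its
  probability is \<open>s\<close> or \<open>t\<close>. With \<open>s = 1/2\<close> and
  \<open>t\<close> equal to 0 or 1 this exhibits a random set \<open>A\<close> of uniform bits
  inside a biased product measure.\<close>

lemma rexp_mixture:
  assumes "finite S" "\<And>e. e \<in> S \<Longrightarrow> p e = m * s + (1 - m) * t"
  shows "rexp S p g = rexp S (\<lambda>_. m) (\<lambda>A. rexp S (\<lambda>e. if e \<in> A then s else t) g)"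
  using assms
proof (induction S arbitrary: g)
  case (insert x S)
  let ?t = "\<lambda>A e. if e \<in> A then s else t"
  let ?I = "\<lambda>h. rexp S (\<lambda>_. m) (\<lambda>A. rexp S (?t A) h)"
  have t: "rexp S (?t (insert x A)) h = rexp S (?t A) h" for A h
    using insert.hyps by (intro rexp_cong) auto
  have "rexp S (\<lambda>_. m) (\<lambda>A. rexp (insert x S) (?t (insert x A)) g)
      = rexp S (\<lambda>_. m) (\<lambda>A. s * rexp S (?t A) (\<lambda>E. g (insert x E)) + (1 - s) * rexp S (?t A) g)"
    using insert.hyps by (intro rexp_cong refl) (simp add: rexp_insert t del: insert_iff, simp)
  moreover have "rexp S (\<lambda>_. m) (\<lambda>A. rexp (insert x S) (?t A) g)
      = rexp S (\<lambda>_. m) (\<lambda>A. t * rexp S (?t A) (\<lambda>E. g (insert x E)) + (1 - t) * rexp S (?t A) g)"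
    using insert.hyps by (intro rexp_cong refl) (auto simp: rexp_insert)
  ultimately have "rexp (insert x S) (\<lambda>_. m) (\<lambda>A. rexp (insert x S) (?t A) g)
      = m * (s * ?I (\<lambda>E. g (insert x E)) + (1 - s) * ?I g)
      + (1 - m) * (t * ?I (\<lambda>E. g (insert x E)) + (1 - t) * ?I g)"
    by (subst rexp_insert[OF insert.hyps]) (simp only: rexp_add rexp_cmult)
  moreover have "rexp (insert x S) p g = p x * ?I (\<lambda>E. g (insert x E)) + (1 - p x) * ?I g"
    using insert by (simp add: rexp_insert)
  moreover have "p x = m * s + (1 - m) * t" using insert.prems by simp
  ultimately show ?case by (simp only:) (simp add: algebra_simps)
qed simp

text \<open>The generating function of a binomial variable. It later averages a bound that decays
  geometrically in the number of uniform bits.\<close>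

lemma rexp_geom:
  assumes "finite S"
  shows "rexp S (\<lambda>_. m) (\<lambda>A. c ^ card A) = (1 - m * (1 - c)) ^ card S"
  using assms
proof (induction S)
  case (insert x S)
  have "rexp S (\<lambda>_. m) (\<lambda>A. c ^ card (insert x A)) = rexp S (\<lambda>_. m) (\<lambda>A. c * c ^ card A)"
    using insert by (intro rexp_cong refl) (metis card_insert_disjoint finite_subset power_Suc subsetD)
  with insert show ?case
    by (simp add: rexp_insert rexp_cmult algebra_simps)
qed simp

text \<open>The bridge from the product measure in \<open>erdos_renyi\<close> to finite sums; the
  induction splits off one coordinate of the product.\<close>

lemma prob_random_subset:
  assumes "finite F" "0 \<le> p" "p \<le> 1"
  shows "measure_pmf.prob (map_pmf (\<lambda>f. {e \<in> F. f e}) (Pi_pmf F False (\<lambda>_. bernoulli_pmf p))) A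
    = rexp F (\<lambda>_. p) (\<lambda>E. of_bool (E \<in> A))"
  using assms
proof (induction F arbitrary: A)
  case (insert x F)
  note p = insert.prems
  let ?B = "Pi_pmf F False (\<lambda>_. bernoulli_pmf p)"
  have eq: "{e \<in> insert x F. (if e = x then b else f e)} = (if b then insert x {e \<in> F. f e} else {e \<in> F. f e})"
    for b f using insert.hyps by auto
  have "map_pmf (\<lambda>f. {e \<in> insert x F. f e}) (Pi_pmf (insert x F) False (\<lambda>_. bernoulli_pmf p))
     = bind_pmf (bernoulli_pmf p) (\<lambda>b. map_pmf (\<lambda>E. if b then insert x E else E)
         (map_pmf (\<lambda>f. {e \<in> F. f e}) ?B))"
    unfolding Pi_pmf_insert'[OF insert.hyps]
    unfolding map_pmf_def bind_assoc_pmf bind_return_pmf fun_upd_def eq ..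
  moreover have "measure_pmf.prob (bind_pmf (bernoulli_pmf p) M) A
     = p * measure_pmf.prob (M True) A + (1 - p) * measure_pmf.prob (M False) A" for M
  proof -
    have "ennreal (measure_pmf.prob (bind_pmf (bernoulli_pmf p) M) A)
       = ennreal (p * measure_pmf.prob (M True) A + (1 - p) * measure_pmf.prob (M False) A)"
      using p by (simp add: measure_pmf.emeasure_eq_measure mult_ac flip: measure_pmf.emeasure_eq_measure)
        (simp add: measure_pmf.emeasure_eq_measure ennreal_mult' mult_ac)
    then show ?thesis using p by (subst (asm) ennreal_inj) auto
  qed
  moreover have "rexp F (\<lambda>_. p) (\<lambda>E. of_bool (E \<in> B))
      = measure_pmf.prob ?B {f. {e \<in> F. f e} \<in> B}" for B
    using insert.IH[of B] insert.prems p by (simp add: vimage_def)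
  from this[of A] this[of "{E. insert x E \<in> A}"]
  have "rexp F (\<lambda>_. p) (\<lambda>E. of_bool (E \<in> A)) = measure_pmf.prob ?B {f. {e \<in> F. f e} \<in> A}"
    and "rexp F (\<lambda>_. p) (\<lambda>E. of_bool (insert x E \<in> A))
      = measure_pmf.prob ?B {f. insert x {e \<in> F. f e} \<in> A}"
    by simp_all
  ultimately show ?case using insert.hyps
    by (simp add: rexp_insert vimage_def)
qed (simp add: measure_return_pmf indicator_def)

section \<open>Building a graph vertex by vertex\<close>

definition oddnb :: "'a set set \<Rightarrow> 'a \<Rightarrow> 'a set \<Rightarrow> bool" where
  "oddnb E v D \<longleftrightarrow> odd (card {u \<in> D. {u, v} \<in> E})"

lemma oddnb_empty [simp]: "\<not> oddnb E v {}"
  by (simp add: oddnb_def)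

lemma oddnb_Un:
  assumes "finite A" "finite B" "A \<inter> B = {}"
  shows "oddnb E v (A \<union> B) \<longleftrightarrow> oddnb E v A \<noteq> oddnb E v B"
proof -
  have "{u \<in> A \<union> B. {u, v} \<in> E} = {u \<in> A. {u, v} \<in> E} \<union> {u \<in> B. {u, v} \<in> E}" by auto
  moreover have "card \<dots> = card {u \<in> A. {u, v} \<in> E} + card {u \<in> B. {u, v} \<in> E}"
    using assms by (intro card_Un_disjoint) auto
  ultimately show ?thesis by (auto simp: oddnb_def)
qed

lemma oddnb_insert:
  assumes "finite A" "x \<notin> A"
  shows "oddnb E v (insert x A) \<longleftrightarrow> oddnb E v A \<noteq> ({x, v} \<in> E)"
proof -
  have "oddnb E v {x} \<longleftrightarrow> {x, v} \<in> E"
    by (cases "{x, v} \<in> E") (auto simp: oddnb_def conj_commute cong: conj_cong)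
  then show ?thesis using oddnb_Un[of "{x}" A E v] assms by auto
qed

lemma oddnb_cong:
  assumes "\<And>u. u \<in> D \<Longrightarrow> {u, v} \<in> E \<longleftrightarrow> {u, v} \<in> E'"
  shows "oddnb E v D \<longleftrightarrow> oddnb E' v D"
proof -
  have "{u \<in> D. {u, v} \<in> E} = {u \<in> D. {u, v} \<in> E'}" using assms by auto
  then show ?thesis by (simp add: oddnb_def)
qed

text \<open>The vertices of \<open>B\<close> carry an extra parity bit, which stands for neighbours outside the
  graph being built; the vertices of \<open>J\<close> may be added without any parity condition.\<close>

inductive grow :: "'a set set \<Rightarrow> 'a set \<Rightarrow> 'a set \<Rightarrow> 'a set \<Rightarrow> 'a set \<Rightarrow> bool"
  for E J B S where
  start: "grow E J B S S"
| step: "grow E J B S D \<Longrightarrow> v \<notin> D \<Longrightarrow> v \<in> J \<or> (v \<in> B \<longleftrightarrow> oddnb E v D) \<Longrightarrow> grow E J B S (insert v D)"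

lemma grow_trans:
  assumes "grow E J B D T" "grow E J B S D"
  shows "grow E J B S T"
  using assms by induction (auto intro: grow.intros)

lemma grow_finite: "grow E J B S D \<Longrightarrow> finite S \<Longrightarrow> finite D"
  by (induction rule: grow.induct) auto

text \<open>A derivation of \<open>D\<close> consults only pairs inside \<open>D\<close> and never
  the bit of a free vertex, and freeing further vertices cannot hurt.\<close>

lemma grow_cong:
  assumes "grow E J B S D"
    and "\<And>e. e \<in> nsets D 2 \<Longrightarrow> e \<in> E \<longleftrightarrow> e \<in> E'" "D \<inter> J \<subseteq> J'" "D \<inter> (B - J') = D \<inter> (B' - J')"
  shows "grow E' J' B' S D"
  using assms
proof induction
  case (step D v)
  have "grow E' J' B' S D"
    using step.prems nsets_mono[of D "insert v D" 2] by (intro step.IH) auto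
  moreover have "oddnb E v D \<longleftrightarrow> oddnb E' v D"
    using step.hyps by (intro oddnb_cong step.prems(1)) auto
  moreover have "v \<in> J' \<or> (v \<in> B' \<longleftrightarrow> oddnb E v D)"
    using step.hyps step.prems by auto
  ultimately show ?case using step.hyps by (blast intro: grow.step)
qed (rule grow.start)

text \<open>When \<open>v\<close> comes first, every later vertex sees it. Moving this contribution
  into the parity bits removes \<open>v\<close> from the graph, so the edges at \<open>v\<close> act
  as a change of the bits of the others.\<close>

lemma grow_first:
  assumes "grow E J (sym_diff B {x. {x, v} \<in> E}) {} D" "v \<notin> D" "v \<in> J \<or> v \<notin> B"
  shows "grow E J B {} (insert v D)"
  using assms
proof induction
  case start
  show ?case using start grow.step[of E J B "{}" "{}" v] grow.start[of E J B "{}"] by simp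
next
  case (step D w)
  have "finite D" using step.hyps(1) grow_finite by blast
  then have "oddnb E w (insert v D) \<longleftrightarrow> oddnb E w D \<noteq> ({w, v} \<in> E)"
    using step.prems by (simp add: oddnb_insert insert_commute)
  with step have "w \<notin> insert v D" "w \<in> J \<or> (w \<in> B \<longleftrightarrow> oddnb E w (insert v D))" by auto
  moreover have "grow E J B {} (insert v D)"
    using step by auto
  ultimately have "grow E J B {} (insert w (insert v D))"
    by (blast intro: grow.step)
  then show ?case by (simp add: insert_commute)
qed

lemma grow_free:
  assumes "finite D" "D \<subseteq> J"
  shows "grow E J B {} D"
  using assms by (induction D) (auto intro: grow.intros)

text \<open>Take for \<open>t\<close> the free vertices whose parity is odd at the moment they are
  added: with these bits on \<open>J\<close> the same order is valid without any free
  vertex.\<close>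

lemma grow_target:
  assumes "grow E J B {} D"
  shows "\<exists>t\<subseteq>J. grow E {} ((B - J) \<union> t) {} D"
  using assms
proof induction
  case start
  show ?case by (auto intro: grow.start)
next
  case (step D v)
  then obtain t where t: "t \<subseteq> J" "grow E {} ((B - J) \<union> t) {} D" by auto
  \<comment> \<open>Only the membership of \<open>v\<close> is adjusted; as \<open>v\<close> is not
    in \<open>D\<close>, the derivation of \<open>D\<close> survives.\<close>
  let ?t = "(t - {v}) \<union> (if v \<in> J \<and> oddnb E v D then {v} else {})"
  have "grow E {} ((B - J) \<union> ?t) {} D"
    using step.hyps by (intro grow_cong[OF t(2)]) auto
  moreover have "v \<in> (B - J) \<union> ?t \<longleftrightarrow> oddnb E v D"
    using step.hyps t by auto
  ultimately have "grow E {} ((B - J) \<union> ?t) {} (insert v D)"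
    using step.hyps by (blast intro: grow.step)
  moreover have "?t \<subseteq> J" using t by auto
  ultimately show ?case by blast
qed

text \<open>Here the bits become what they stand for: once they record the neighbours in
  \<open>S\<close>, the construction from nothing is a genuine construction on top of
  \<open>S\<close>.\<close>

lemma grow_shift:
  assumes "grow E {} B {} D" "finite S" "S \<inter> D = {}" "\<And>v. v \<in> D \<Longrightarrow> v \<in> B \<longleftrightarrow> oddnb E v S"
  shows "grow E {} {} S (S \<union> D)"
  using assms
proof induction
  case (step D v)
  have "finite D" using step.hyps(1) grow_finite by blast
  with step have "v \<notin> S \<union> D" "\<not> oddnb E v (S \<union> D)" by (auto simp: oddnb_Un)
  moreover have "grow E {} {} S (S \<union> D)" using step by auto
  ultimately have "grow E {} {} S (insert v (S \<union> D))"
    by (blast intro: grow.step)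
  then show ?case by simp
qed (auto intro: grow.start)

section \<open>Parity of the number of edges, and the passage to orderings\<close>

lemma nsets2_insert:
  assumes "v \<notin> D"
  shows "nsets (insert v D) 2 = (\<lambda>u. {u, v}) ` D \<union> nsets D 2"
  using assms by (auto simp: nsets_2_eq)

lemma star_disjoint: "v \<notin> D \<Longrightarrow> (\<lambda>u. {u, v}) ` D' \<inter> nsets D 2 = {}"
  by (auto simp: nsets_def)

lemma inj_on_star: "inj_on (\<lambda>u. {u, v}) A"
  by (auto simp: inj_on_def doubleton_eq_iff)

lemma even_edges_insert:
  assumes "finite D" "v \<notin> D"
  shows "even (card (E \<inter> nsets (insert v D) 2)) \<longleftrightarrow> (even (card (E \<inter> nsets D 2)) \<longleftrightarrow> \<not> oddnb E v D)"
proof -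
  have "E \<inter> nsets (insert v D) 2 = (\<lambda>u. {u, v}) ` {u \<in> D. {u, v} \<in> E} \<union> (E \<inter> nsets D 2)"
    using assms by (auto simp: nsets2_insert)
  moreover have "card \<dots> = card ((\<lambda>u. {u, v}) ` {u \<in> D. {u, v} \<in> E}) + card (E \<inter> nsets D 2)"
    using assms star_disjoint[of v D]
    by (intro card_Un_disjoint) (auto simp: finite_imp_finite_nsets)
  moreover have "card ((\<lambda>u. {u, v}) ` {u \<in> D. {u, v} \<in> E}) = card {u \<in> D. {u, v} \<in> E}"
    by (intro card_image inj_on_star)
  ultimately show ?thesis by (auto simp: oddnb_def)
qed

text \<open>Every added vertex contributes an even number of new edges.\<close>

lemma grow_parity:
  assumes "grow E {} {} S D" "finite S"
  shows "even (card (E \<inter> nsets D 2)) \<longleftrightarrow> even (card (E \<inter> nsets S 2))"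
  using assms
proof induction
  case (step D v)
  then show ?case using grow_finite[OF step.hyps(1)] by (simp add: even_edges_insert)
qed simp

text \<open>The ordering is the construction read backwards: a vertex added later comes earlier, and
  \<open>a\<close>, \<open>b\<close> take the two unconstrained last positions.\<close>

lemma even_degenerate_grow:
  assumes "grow E {} {} {a, b} D" "a \<noteq> b"
  shows "even_degenerate D E"
  using assms
proof induction
  case start
  have "bij_betw (\<lambda>i::nat. if i = 1 then a else b) {1..2} {a, b}"
    using start by (auto simp: bij_betw_def inj_on_def image_def)
  then show ?case using start unfolding even_degenerate_def
    by (intro exI[of _ "\<lambda>i. if i = 1 then a else b"]) (auto simp: numeral_2_eq_2)
next
  case (step D w)
  then have fin: "finite D" using grow_finite by blast
  let ?k = "card D"
  from step obtain v where v: "bij_betw v {1..?k} D"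
    and ev: "\<And>i. 1 \<le> i \<Longrightarrow> i + 2 \<le> ?k \<Longrightarrow> even (card {u \<in> v ` {i + 1..?k}. {v i, u} \<in> E})"
    unfolding even_degenerate_def by blast
  define v' where "v' i = (if i = 1 then w else v (i - 1))" for i
  have im: "v' ` {i + 1..Suc ?k} = v ` {i..?k}" if "i \<ge> 1" for i
  proof -
    have "{i + 1..Suc ?k} = Suc ` {i..?k}" by simp
    then have "v' ` {i + 1..Suc ?k} = (\<lambda>i. v' (Suc i)) ` {i..?k}" by (simp only: image_image)
    also have "\<dots> = v ` {i..?k}" using that by (intro image_cong) (auto simp: v'_def)
    finally show ?thesis .
  qed
  have all: "{1..Suc ?k} = insert 1 {1 + 1..Suc ?k}" by auto
  have "v' ` {1..Suc ?k} = insert w D"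
    unfolding all image_insert im[OF order_refl] using v by (simp add: v'_def bij_betw_def)
  moreover have "card (insert w D) = Suc ?k" using fin step.hyps by simp
  ultimately have bij: "bij_betw v' {1..card (insert w D)} (insert w D)"
    by (auto simp: bij_betw_def intro!: eq_card_imp_inj_on)
  have "even (card {u \<in> v' ` {i + 1..Suc ?k}. {v' i, u} \<in> E})" if i: "1 \<le> i" "i + 2 \<le> Suc ?k" for i
  proof (cases "i = 1")
    case True
    then have "v' ` {i + 1..Suc ?k} = D" using im[of 1] v by (simp add: bij_betw_def)
    then show ?thesis using step.hyps True by (simp add: oddnb_def v'_def insert_commute)
  next
    case False
    then show ?thesis using im[of i] ev[of "i - 1"] i by (simp add: v'_def)
  qed
  then show ?case unfolding even_degenerate_def
    using bij \<open>card (insert w D) = Suc ?k\<close> by (intro exI[of _ v']) auto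
qed

section \<open>Building the middle part\<close>

text \<open>Starting with \<open>v\<close> is one of the possible orders, which gives the
  inequality. The edges from \<open>v\<close> to \<open>X\<close> turn into the random change
  \<open>N\<close> of the bits; those from \<open>v\<close> to \<open>J\<close> are integrated out
  because free vertices ignore their bits. It covers both an ordinary \<open>v\<close> with even bit
  and a free \<open>v\<close>.\<close>

lemma grow_expose_first:
  assumes fin: "finite X" "finite J" and v: "v \<in> X \<union> J" "v \<in> J \<or> v \<notin> B"
    and p: "0 \<le> p" "p \<le> 1" and D: "D = X \<union> J - {v}"
  shows "rexp (nsets (X \<union> J) 2) (\<lambda>_. p) (\<lambda>E. of_bool (\<not> grow E J B {} (X \<union> J)))
    \<le> rexp (X - {v}) (\<lambda>_. p) (\<lambda>N. rexp (nsets D 2) (\<lambda>_. p)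
         (\<lambda>E. of_bool (\<not> grow E (J - {v}) (sym_diff B N) {} D)))"
proof -
  let ?s = "\<lambda>u. {u, v}"
  have XJ: "X \<union> J = insert v D" "v \<notin> D" and finD: "finite D"
    using v fin D by auto
  have "rexp (nsets (X \<union> J) 2) (\<lambda>_. p) (\<lambda>E. of_bool (\<not> grow E J B {} (X \<union> J)))
     = rexp D (\<lambda>_. p) (\<lambda>N. rexp (nsets D 2) (\<lambda>_. p)
         (\<lambda>E. of_bool (\<not> grow (?s ` N \<union> E) J B {} (insert v D))))"
    unfolding XJ(1) nsets2_insert[OF XJ(2)]
    using finD star_disjoint[OF XJ(2)]
    by (subst rexp_Un) (auto simp: rexp_image[OF _ inj_on_star] finite_imp_finite_nsets)
  also have "\<dots> \<le> rexp D (\<lambda>_. p) (\<lambda>N. rexp (nsets D 2) (\<lambda>_. p)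
         (\<lambda>E. of_bool (\<not> grow E (J - {v}) (sym_diff B (N \<inter> (X - {v}))) {} D)))"
  proof (intro rexp_mono)
    fix N E assume N: "N \<subseteq> D" and E: "E \<subseteq> nsets D 2"
    have edge: "{x, v} \<in> ?s ` N \<union> E \<longleftrightarrow> x \<in> N" for x
      using E XJ by (auto simp: doubleton_eq_iff)
    have "grow (?s ` N \<union> E) J B {} (insert v D)"
      if "grow E (J - {v}) (sym_diff B (N \<inter> (X - {v}))) {} D"
    proof (rule grow_first[OF grow_cong[OF that]])
      show "e \<in> E \<longleftrightarrow> e \<in> ?s ` N \<union> E" if "e \<in> nsets D 2" for e
        using that star_disjoint[OF XJ(2), of N] by auto
      show "D \<inter> (sym_diff B (N \<inter> (X - {v})) - J)
          = D \<inter> (sym_diff B {x. {x, v} \<in> ?s ` N \<union> E} - J)"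
        unfolding edge using D by auto
    qed (use XJ v in auto)
    then show "of_bool (\<not> grow (?s ` N \<union> E) J B {} (insert v D))
      \<le> (of_bool (\<not> grow E (J - {v}) (sym_diff B (N \<inter> (X - {v}))) {} D) :: real)"
      by auto
  qed (use p in auto)
  also have "\<dots> = rexp (X - {v}) (\<lambda>_. p) (\<lambda>N. rexp (nsets D 2) (\<lambda>_. p)
         (\<lambda>E. of_bool (\<not> grow E (J - {v}) (sym_diff B N) {} D)))"
    using finD D by (intro rexp_restrict) auto
  finally show ?thesis .
qed

text \<open>An atom has one factor \<open>p\<close> or \<open>1 - p\<close> per element of
  \<open>X\<close>, and both are at most \<open>m\<close>.\<close>

lemma rexp_single:
  assumes "finite X" "0 \<le> p" "p \<le> 1" "p \<le> m" "1 - p \<le> m"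
  shows "rexp X (\<lambda>_. p) (\<lambda>N. of_bool (N = A)) \<le> m ^ card X"
  using assms
proof (induction X arbitrary: A)
  case (insert x X)
  have nn: "0 \<le> rexp X (\<lambda>_. p) (\<lambda>N. of_bool (N = A'))" for A'
    using insert.prems by (intro rexp_nonneg) auto
  have zero: "rexp X (\<lambda>_. p) g = 0" if "\<And>N. N \<subseteq> X \<Longrightarrow> g N = 0" for g
    using rexp_cong[of X X "\<lambda>_. p" "\<lambda>_. p" g "\<lambda>_. 0"] that insert.hyps by simp
  show ?case
  proof (cases "x \<in> A")
    case True
    have "rexp X (\<lambda>_. p) (\<lambda>N. of_bool (insert x N = A)) = rexp X (\<lambda>_. p) (\<lambda>N. of_bool (N = A - {x}))"
      using True insert.hyps by (auto intro!: rexp_cong simp: of_bool_def)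
    moreover have "rexp X (\<lambda>_. p) (\<lambda>N. of_bool (N = A)) = 0"
      using True insert.hyps by (intro zero) auto
    moreover have "p * rexp X (\<lambda>_. p) (\<lambda>N. of_bool (N = A - {x})) \<le> m * m ^ card X"
      using insert nn by (intro mult_mono) auto
    ultimately show ?thesis using insert.hyps by (simp add: rexp_insert)
  next
    case False
    have "rexp X (\<lambda>_. p) (\<lambda>N. of_bool (insert x N = A)) = 0"
      using False by (intro zero) auto
    moreover have "(1 - p) * rexp X (\<lambda>_. p) (\<lambda>N. of_bool (N = A)) \<le> m * m ^ card X"
      using insert nn by (intro mult_mono) auto
    ultimately show ?thesis using insert.hyps by (simp add: rexp_insert)
  qed
qed simp

text \<open>With \<open>x\<close> ordinary and \<open>j\<close> free vertices left and fresh random bits, all \<open>x\<close> bits are odd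
  with probability at most \<open>\<kappa>\<^sup>2 ^ x\<close>, and only then is a free vertex consumed. The bound is chosen
  to satisfy the resulting recursion \<open>mid_bound_rec\<close>.\<close>

definition mid_bound :: "real \<Rightarrow> nat \<Rightarrow> nat \<Rightarrow> real" where
  "mid_bound \<kappa> x j = \<kappa> ^ j * exp ((1 - \<kappa> ^ x) / (1 - \<kappa>)\<^sup>2)"

text \<open>With \<open>y = \<kappa> ^ x\<close>, division by the right-hand side leaves
  \<open>exp (- (y / (1 - \<kappa>))) + \<kappa> * y\<^sup>2 \<le> 1\<close>. This follows from
  \<open>exp (- z) \<le> 1 / (1 + z)\<close> and \<open>y \<le> 1\<close>.\<close>

lemma mid_bound_rec:
  assumes k: "0 < \<kappa>" "\<kappa> < 1"
  shows "mid_bound \<kappa> x (Suc j) + (\<kappa>\<^sup>2) ^ Suc x * mid_bound \<kappa> (Suc x) j \<le> mid_bound \<kappa> (Suc x) (Suc j)"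
proof -
  define y where "y = \<kappa> ^ x"
  define C where "C = 1 / (1 - \<kappa>)\<^sup>2"
  have y: "0 < y" "y \<le> 1" using k by (auto simp: y_def power_le_one)
  have "exp (- (y / (1 - \<kappa>))) \<le> 1 / (1 + y / (1 - \<kappa>))"
    using exp_ge_add_one_self[of "y / (1 - \<kappa>)"] y k
    by (simp add: exp_minus field_simps add_pos_pos)
  also have "\<dots> \<le> 1 - \<kappa> * y\<^sup>2"
  proof -
    have "\<kappa> * y * (1 - \<kappa>) + \<kappa> * y\<^sup>2 \<le> \<kappa> * 1 * (1 - \<kappa>) + \<kappa> * 1"
      using k y by (intro add_mono mult_mono) (auto simp: power_le_one)
    also have "\<dots> = 1 - (1 - \<kappa>)\<^sup>2" by (simp add: power2_eq_square algebra_simps)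
    also have "\<dots> \<le> 1" by simp
    finally have "y * (\<kappa> * y * (1 - \<kappa>) + \<kappa> * y\<^sup>2) \<le> y * 1"
      using y by (intro mult_left_mono) auto
    then have "1 - \<kappa> \<le> (1 - \<kappa> * y\<^sup>2) * (1 - \<kappa> + y)"
      by (simp add: power2_eq_square algebra_simps)
    moreover have "1 / (1 + y / (1 - \<kappa>)) = (1 - \<kappa>) / (1 - \<kappa> + y)"
      using k y by (simp add: field_simps)
    ultimately show ?thesis using k y by (simp add: divide_le_eq)
  qed
  finally have e: "exp (- (y / (1 - \<kappa>))) + \<kappa> * y\<^sup>2 \<le> 1" by simp
  have "C * (1 - y) = C * (1 - \<kappa> * y) + - (y / (1 - \<kappa>))"
  proof -
    have "C * (1 - \<kappa>) = 1 / (1 - \<kappa>)" using k by (simp add: C_def power2_eq_square)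
    then have "y * (C * (1 - \<kappa>)) = y / (1 - \<kappa>)" by simp
    then show ?thesis by (simp add: algebra_simps)
  qed
  then have m1: "mid_bound \<kappa> x (Suc j) = \<kappa> ^ Suc j * exp (C * (1 - \<kappa> * y)) * exp (- (y / (1 - \<kappa>)))"
    by (simp add: mid_bound_def y_def C_def exp_add[symmetric] mult_ac)
  have m2: "(\<kappa>\<^sup>2) ^ Suc x * mid_bound \<kappa> (Suc x) j = \<kappa> ^ Suc j * exp (C * (1 - \<kappa> * y)) * (\<kappa> * y\<^sup>2)"
    by (simp add: mid_bound_def y_def C_def power_mult_distrib power2_eq_square mult_ac)
  have m3: "mid_bound \<kappa> (Suc x) (Suc j) = \<kappa> ^ Suc j * exp (C * (1 - \<kappa> * y))"
    by (simp add: mid_bound_def y_def C_def mult_ac)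
  have "\<kappa> ^ Suc j * exp (C * (1 - \<kappa> * y)) * (exp (- (y / (1 - \<kappa>))) + \<kappa> * y\<^sup>2)
     \<le> \<kappa> ^ Suc j * exp (C * (1 - \<kappa> * y)) * 1"
    using e k by (intro mult_left_mono) auto
  then show ?thesis unfolding m1 m2 m3 by (simp add: distrib_left)
qed

lemma mid_bound_nonneg: "0 \<le> \<kappa> \<Longrightarrow> 0 \<le> mid_bound \<kappa> x j"
  by (simp add: mid_bound_def)

text \<open>Induction on the number of vertices left. A vertex of \<open>X\<close> with even bit is
  inserted if there is one, and a free vertex otherwise; either way its edges supply fresh bits for
  the rest. The assumptions on \<open>p\<close> say that \<open>p\<close> and \<open>1 - p\<close>
  are both at most \<open>\<kappa>\<^sup>2\<close>.\<close>

lemma grow_random_bits: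
  assumes k: "0 < \<kappa>" "\<kappa> < 1" and p: "1 - \<kappa>\<^sup>2 \<le> p" "p \<le> \<kappa>\<^sup>2"
    and "finite X" "finite J" "X \<inter> J = {}"
  shows "rexp X (\<lambda>_. p) (\<lambda>N. rexp (nsets (X \<union> J) 2) (\<lambda>_. p)
      (\<lambda>E. of_bool (\<not> grow E J (sym_diff B N) {} (X \<union> J)))) \<le> mid_bound \<kappa> (card X) (card J)"
  using assms(5-)
proof (induction "card X + card J" arbitrary: X J B rule: less_induct)
  case less
  have p01: "0 \<le> p" "p \<le> 1" using p k power_le_one[of \<kappa> 2] by (auto simp: power2_eq_square) 
  let ?g = "\<lambda>N. rexp (nsets (X \<union> J) 2) (\<lambda>_. p) (\<lambda>E. of_bool (\<not> grow E J (sym_diff B N) {} (X \<union> J)))"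
  have fin: "finite (nsets (X \<union> J) 2)" using less.prems by (simp add: finite_imp_finite_nsets)
  have le1: "?g N \<le> 1" for N using fin p01 by (intro rexp_le) auto
  consider "X = {}" | "X \<noteq> {}" "J = {}" | "X \<noteq> {}" "J \<noteq> {}" by blast
  then show ?case
  proof cases
    case 1
    then show ?thesis using less.prems k fin by (simp add: grow_free mid_bound_nonneg)
  next
    case 2
    have "rexp X (\<lambda>_. p) ?g \<le> 1" using p01 less.prems by (intro rexp_le le1) auto
    also have "\<dots> \<le> mid_bound \<kappa> (card X) (card J)"
      using 2 k by (auto simp: mid_bound_def power_le_one)
    finally show ?thesis .
  next
    case 3
    obtain h where h: "h \<in> J" using 3 by auto
    obtain x j where x: "card X = Suc x" and j: "card J = Suc j"
      using 3 less.prems by (metis card_eq_0_iff not0_implies_Suc)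
    \<comment> \<open>All bits are odd for the single value \<open>N = X - B\<close>; only there is
      a free vertex spent.\<close>
    have "?g N \<le> mid_bound \<kappa> x (Suc j) + of_bool (N = X - B) * mid_bound \<kappa> (Suc x) j"
      if "N \<subseteq> X" for N
    proof (cases "X \<subseteq> sym_diff B N")
      case True
      have XJ: "X \<union> J - {h} = X \<union> (J - {h})" "X - {h} = X" using h less.prems by auto
      have "?g N \<le> rexp (X - {h}) (\<lambda>_. p) (\<lambda>N'. rexp (nsets (X \<union> (J - {h})) 2) (\<lambda>_. p)
         (\<lambda>E. of_bool (\<not> grow E (J - {h}) (sym_diff (sym_diff B N) N') {} (X \<union> (J - {h})))))"
        using less.prems h p01 XJ by (intro grow_expose_first) auto
      also have "\<dots> \<le> mid_bound \<kappa> (card X) (card (J - {h}))"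
        unfolding XJ(2) using h j x less.prems by (intro less.hyps) auto
      finally have "?g N \<le> mid_bound \<kappa> (Suc x) j" using h x j less.prems by simp
      moreover have "N = X - B" using True that by auto
      moreover have "0 \<le> mid_bound \<kappa> x (Suc j)" using k by (simp add: mid_bound_nonneg)
      ultimately show ?thesis by simp
    next
      case False
      then obtain v where v: "v \<in> X" "v \<notin> sym_diff B N" by blast
      have XJ: "X \<union> J - {v} = (X - {v}) \<union> J" "J - {v} = J" using v less.prems by auto
      have "?g N \<le> rexp (X - {v}) (\<lambda>_. p) (\<lambda>N'. rexp (nsets (X - {v} \<union> J) 2) (\<lambda>_. p)
         (\<lambda>E. of_bool (\<not> grow E (J - {v}) (sym_diff (sym_diff B N) N') {} (X - {v} \<union> J))))"
        using less.prems v p01 XJ by (intro grow_expose_first) auto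
      also have "\<dots> \<le> mid_bound \<kappa> (card (X - {v})) (card J)"
        unfolding XJ(2) using v j x less.prems by (intro less.hyps) auto
      finally have "?g N \<le> mid_bound \<kappa> x (Suc j)" using v x j less.prems by simp
      moreover have "0 \<le> of_bool (N = X - B) * mid_bound \<kappa> (Suc x) j" using k by (simp add: mid_bound_nonneg)
      ultimately show ?thesis by linarith
    qed
    then have "rexp X (\<lambda>_. p) ?g
       \<le> rexp X (\<lambda>_. p) (\<lambda>N. mid_bound \<kappa> x (Suc j) + of_bool (N = X - B) * mid_bound \<kappa> (Suc x) j)"
      using p01 by (intro rexp_mono) auto
    also have "\<dots> = mid_bound \<kappa> x (Suc j)
        + rexp X (\<lambda>_. p) (\<lambda>N. of_bool (N = X - B)) * mid_bound \<kappa> (Suc x) j"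
      using less.prems by (simp only: rexp_add rexp_multc rexp_const)
    also have "\<dots> \<le> mid_bound \<kappa> x (Suc j) + (\<kappa>\<^sup>2) ^ Suc x * mid_bound \<kappa> (Suc x) j"
    proof -
      have "rexp X (\<lambda>_. p) (\<lambda>N. of_bool (N = X - B)) \<le> (\<kappa>\<^sup>2) ^ Suc x"
        unfolding x[symmetric] using less.prems p p01 by (intro rexp_single) auto
      then show ?thesis using k by (intro add_left_mono mult_right_mono) (auto simp: mid_bound_nonneg)
    qed
    also have "\<dots> \<le> mid_bound \<kappa> (Suc x) (Suc j)" using k by (rule mid_bound_rec)
    finally show ?thesis using x j by simp
  qed
qed

text \<open>The bits in \<open>B\<close> are arbitrary here. One free vertex is inserted first to
  randomize them, which explains the exponent \<open>card J - 1\<close>.\<close>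

lemma grow_random:
  assumes k: "0 < \<kappa>" "\<kappa> < 1" and p: "1 - \<kappa>\<^sup>2 \<le> p" "p \<le> \<kappa>\<^sup>2"
    and fin: "finite X" "finite J" "X \<inter> J = {}" "J \<noteq> {}"
  shows "rexp (nsets (X \<union> J) 2) (\<lambda>_. p) (\<lambda>E. of_bool (\<not> grow E J B {} (X \<union> J)))
    \<le> \<kappa> ^ (card J - 1) * exp (1 / (1 - \<kappa>)\<^sup>2)"
proof -
  obtain h where h: "h \<in> J" using fin by auto
  have XJ: "X \<union> J - {h} = X \<union> (J - {h})" "X - {h} = X" using h fin by auto
  have p01: "0 \<le> p" "p \<le> 1" using p k power_le_one[of \<kappa> 2] by (auto simp: power2_eq_square)
  have "rexp (nsets (X \<union> J) 2) (\<lambda>_. p) (\<lambda>E. of_bool (\<not> grow E J B {} (X \<union> J)))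
     \<le> rexp (X - {h}) (\<lambda>_. p) (\<lambda>N. rexp (nsets (X \<union> (J - {h})) 2) (\<lambda>_. p)
         (\<lambda>E. of_bool (\<not> grow E (J - {h}) (sym_diff B N) {} (X \<union> (J - {h})))))"
    using fin h p01 XJ by (intro grow_expose_first) auto
  also have "\<dots> \<le> mid_bound \<kappa> (card X) (card (J - {h}))"
    unfolding XJ(2) using fin k p by (intro grow_random_bits) auto
  also have "\<dots> \<le> \<kappa> ^ (card J - 1) * exp (1 / (1 - \<kappa>)\<^sup>2)"
    unfolding mid_bound_def using k fin h
    by (intro mult_mono) (auto simp: divide_right_mono)
  finally show ?thesis .
qed

section \<open>The bottom and the top part\<close>

text \<open>The list is processed from its last element to its first one, so that the head of the list
  meets the decisions made on the tail. The set \<open>d\<close> plays the role of the vertices of odd degree,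
  which \<open>E\<close> itself does not determine as long as the pads are hidden.\<close>

fun sweep :: "'a set set \<Rightarrow> 'a set \<Rightarrow> 'a set \<Rightarrow> 'a set \<Rightarrow> 'a list \<Rightarrow> 'a set \<times> 'a set" where
  "sweep E d S w [] = ({}, {})"
| "sweep E d S w (q # qs) = (let (P, Q) = sweep E d S w qs in
     if \<not> oddnb E q (S \<union> P) \<and> (oddnb E q Q \<longleftrightarrow> q \<in> d)
     then if q \<in> w then (insert q P, Q) else (P, insert q Q)
     else (P, Q))"

lemma sweep_subset:
  assumes "sweep E d S w qs = (P, Q)"
  shows "P \<union> Q \<subseteq> set qs"
  using assms
proof (induction qs arbitrary: P Q)
  case (Cons q qs)
  obtain P' Q' where "sweep E d S w qs = (P', Q')" by fastforce
  with Cons show ?case by (fastforce split: if_splits)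
qed simp

lemma sweep_disjoint:
  assumes "sweep E d S w qs = (P, Q)" "distinct qs"
  shows "P \<inter> Q = {}"
  using assms
proof (induction qs arbitrary: P Q)
  case (Cons q qs)
  obtain P' Q' where "sweep E d S w qs = (P', Q')" by fastforce
  with Cons sweep_subset[OF this] show ?case by (auto split: if_splits)
qed simp

text \<open>Intermediate states are contained in the final \<open>P\<close> and \<open>Q\<close>, so
  the run consults no other pairs. This is what leaves the remaining edges independent of the
  outcome.\<close>

lemma sweep_cong:
  assumes "sweep E d S w qs = (P, Q)"
    and "\<And>q u. q \<in> set qs \<Longrightarrow> u \<in> S \<union> P \<union> Q \<Longrightarrow> {u, q} \<in> E \<longleftrightarrow> {u, q} \<in> E'"
    and "\<And>q. q \<in> set qs \<Longrightarrow> q \<in> d \<longleftrightarrow> q \<in> d'" "\<And>q. q \<in> set qs \<Longrightarrow> q \<in> w \<longleftrightarrow> q \<in> w'"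
  shows "sweep E' d' S w' qs = (P, Q)"
  using assms
proof (induction qs arbitrary: P Q)
  case (Cons q qs)
  obtain P' Q' where PQ': "sweep E d S w qs = (P', Q')" by fastforce
  then have sub: "P' \<subseteq> P" "Q' \<subseteq> Q" using Cons.prems(1) by (auto split: if_splits)
  have "sweep E' d' S w' qs = (P', Q')"
    using sub Cons.prems by (intro Cons.IH[OF PQ']) auto
  moreover have "oddnb E q (S \<union> P') \<longleftrightarrow> oddnb E' q (S \<union> P')" "oddnb E q Q' \<longleftrightarrow> oddnb E' q Q'"
    using sub Cons.prems(2) by (auto intro!: oddnb_cong)
  ultimately show ?case
    using PQ' Cons.prems(1) Cons.prems(3)[of q] Cons.prems(4)[of q] by (auto split: if_splits)
qed simp

lemma sweep_bottom:
  assumes "sweep E d S w qs = (P, Q)" "distinct qs" "S \<inter> set qs = {}"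
  shows "grow E {} {} S (S \<union> P)"
  using assms
proof (induction qs arbitrary: P Q)
  case (Cons q qs)
  obtain P' Q' where PQ': "sweep E d S w qs = (P', Q')" by fastforce
  then have "grow E {} {} S (S \<union> P')" using Cons by simp
  moreover have "q \<notin> S \<union> P'" using Cons.prems sweep_subset[OF PQ'] by auto
  ultimately show ?case
    using PQ' Cons.prems(1) by (auto split: if_splits intro: grow.step)
qed (auto intro: grow.start)

text \<open>The neighbours of \<open>q\<close> outside \<open>Q\<close> have parity equal to the
  difference of its degree parity, recorded in \<open>d\<close>, and its parity into
  \<open>Q\<close>. The vertices of \<open>Q\<close> chosen earlier in the run are added later in
  the construction.\<close>

lemma sweep_top:
  assumes "sweep E d S w qs = (P, Q)" "distinct qs" "finite V" "set qs \<subseteq> V" "E \<subseteq> nsets V 2"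
    and "\<And>q. q \<in> set qs \<Longrightarrow> q \<in> d \<longleftrightarrow> oddnb E q V"
  shows "grow E {} {} (V - Q) V"
  using assms
proof (induction qs arbitrary: P Q)
  case (Cons q qs)
  obtain P' Q' where PQ': "sweep E d S w qs = (P', Q')" by fastforce
  then have IH: "grow E {} {} (V - Q') V" using Cons by simp
  show ?case
  proof (cases "Q = Q'")
    case False
    then have Q: "Q = insert q Q'" and ev: "oddnb E q Q' \<longleftrightarrow> q \<in> d"
      using PQ' Cons.prems(1) by (auto split: if_splits)
    have sub: "Q' \<subseteq> set qs" "q \<notin> Q'" "q \<in> V" "Q' \<subseteq> V" "finite Q'"
      using sweep_subset[OF PQ'] Cons.prems(2-4) by (auto intro: finite_subset)
    have "V = (V - Q) \<union> insert q Q'" using Q sub by auto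
    then have "oddnb E q V \<longleftrightarrow> oddnb E q (V - Q) \<noteq> oddnb E q (insert q Q')"
      using oddnb_Un[of "V - Q" "insert q Q'" E q] Q sub Cons.prems(3) by auto
    moreover have "oddnb E q (insert q Q') \<longleftrightarrow> oddnb E q Q'"
      using sub Cons.prems(5) by (auto simp: oddnb_insert nsets_def)
    ultimately have "\<not> oddnb E q (V - Q)" using ev Cons.prems(6)[of q] by auto
    then have "grow E {} {} (V - Q) (insert q (V - Q))"
      using Q by (intro grow.step grow.start) auto
    moreover have "insert q (V - Q) = V - Q'" using Q sub by auto
    ultimately show ?thesis using grow_trans[OF IH] by simp
  qed (use IH in simp)
qed (auto intro: grow.start)

section \<open>Parities of random sets, and pairs of sweeps\<close>

lemma rexp_even_ge:
  assumes "finite X" "0 < \<delta>" "\<delta> \<le> p" "p \<le> 1 - \<delta>"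
  shows "\<delta> \<le> rexp X (\<lambda>_. p) (\<lambda>N. of_bool (even (card N)))"
  using assms
proof (induction X)
  case (insert x X)
  let ?e = "rexp X (\<lambda>_. p) (\<lambda>N. of_bool (even (card N)))"
  have "rexp X (\<lambda>_. p) (\<lambda>N. of_bool (even (card (insert x N)))) = rexp X (\<lambda>_. p) (\<lambda>N. 1 - of_bool (even (card N)))"
  proof (intro rexp_cong refl)
    fix N assume "N \<subseteq> X"
    then have "finite N" "x \<notin> N" using insert finite_subset by auto
    then show "of_bool (even (card (insert x N))) = (1 - of_bool (even (card N)) :: real)" by simp
  qed
  then have eq: "rexp (insert x X) (\<lambda>_. p) (\<lambda>N. of_bool (even (card N))) = p * (1 - ?e) + (1 - p) * ?e"
    using insert.hyps by (simp add: rexp_insert rexp_diff)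
  have "?e \<le> 1" using insert by (intro rexp_le) auto
  then have "\<delta> * (1 - ?e) + \<delta> * ?e \<le> p * (1 - ?e) + (1 - p) * ?e"
    using insert by (intro add_mono mult_right_mono) auto
  then show ?case unfolding eq by (simp add: algebra_simps)
qed simp

text \<open>The first set \<open>A\<close> cuts \<open>X\<close> into \<open>X \<inter> A\<close>
  and \<open>X - A\<close>, and the remaining conditions are imposed on both pieces independently;
  this squares the bound. Carrying the evenness of \<open>card N\<close> along yields the condition
  for \<open>A\<close> itself.\<close>

lemma rexp_all_even_ge:
  assumes "finite X" "0 < \<delta>" "\<delta> \<le> p" "p \<le> 1 - \<delta>"
  shows "\<delta> ^ (2 ^ length As)
    \<le> rexp X (\<lambda>_. p) (\<lambda>N. of_bool (even (card N) \<and> (\<forall>A\<in>set As. even (card (N \<inter> A)))))"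
  using assms
proof (induction As arbitrary: X)
  case Nil
  then show ?case using rexp_even_ge by simp
next
  case (Cons A As)
  let ?c = "\<lambda>N. even (card N) \<and> (\<forall>A\<in>set As. even (card (N \<inter> A)))"
  let ?Y = "X \<inter> A" and ?Z = "X - A"
  let ?r = "\<lambda>X. rexp X (\<lambda>_. p) (\<lambda>N. of_bool (?c N) :: real)"
  have fin: "finite ?Y" "finite ?Z" using Cons.prems by auto
  have "\<delta> ^ (2 ^ length (A # As)) = \<delta> ^ (2 ^ length As) * \<delta> ^ (2 ^ length As)"
    by (simp add: power_add[symmetric] mult_2)
  also have "\<dots> \<le> ?r ?Y * ?r ?Z"
    using Cons.IH[OF fin(1)] Cons.IH[OF fin(2)] Cons.prems
    by (intro mult_mono) (auto intro: order_trans[rotated])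
  also have "\<dots> = rexp ?Y (\<lambda>_. p) (\<lambda>N. rexp ?Z (\<lambda>_. p) (\<lambda>N'. of_bool (?c N) * of_bool (?c N')))"
    by (simp only: rexp_cmult rexp_multc)
  also have "\<dots> \<le> rexp ?Y (\<lambda>_. p) (\<lambda>N. rexp ?Z (\<lambda>_. p)
      (\<lambda>N'. of_bool (even (card (N \<union> N')) \<and> (\<forall>A\<in>set (A # As). even (card ((N \<union> N') \<inter> A))))))"
  proof (intro rexp_mono)
    fix N N' assume N: "N \<subseteq> ?Y" "N' \<subseteq> ?Z"
    have "finite N" "finite N'" using N fin finite_subset by blast+
    moreover have "N \<inter> N' = {}" using N by auto
    ultimately have "card ((N \<union> N') \<inter> B) = card (N \<inter> B) + card (N' \<inter> B)" for B
      unfolding Int_Un_distrib2 by (intro card_Un_disjoint) auto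
    from this this[of UNIV] have card: "card ((N \<union> N') \<inter> B) = card (N \<inter> B) + card (N' \<inter> B)"
      "card (N \<union> N') = card N + card N'" for B by auto
    have "N \<inter> A = N" "N' \<inter> A = {}" using N by auto
    then show "of_bool (?c N) * of_bool (?c N')
      \<le> (of_bool (even (card (N \<union> N')) \<and> (\<forall>A\<in>set (A # As). even (card ((N \<union> N') \<inter> A)))) :: real)"
      by (auto simp: card)
  qed (use Cons.prems in auto)
  also have "\<dots> = rexp (?Y \<union> ?Z) (\<lambda>_. p)
      (\<lambda>N. of_bool (even (card N) \<and> (\<forall>A\<in>set (A # As). even (card (N \<inter> A)))))"
    using fin by (subst rexp_Un) auto
  also have "?Y \<union> ?Z = X" by auto
  finally show ?case .
qed

text \<open>The bias of a parity is the product of the biases \<open>1 - 2 * p\<close> of its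
  elements.\<close>

lemma rexp_parity:
  assumes "finite D"
  shows "rexp D (\<lambda>_. p) (\<lambda>N. of_bool (odd (card N) \<longleftrightarrow> b))
    = (1 + (if b then -1 else 1) * (1 - 2 * p) ^ card D) / 2"
  using assms
proof (induction D arbitrary: b)
  case (insert x D)
  have "rexp D (\<lambda>_. p) (\<lambda>N. of_bool (odd (card (insert x N)) \<longleftrightarrow> b))
      = rexp D (\<lambda>_. p) (\<lambda>N. of_bool (odd (card N) \<longleftrightarrow> \<not> b))"
  proof (intro rexp_cong refl)
    fix N assume "N \<subseteq> D"
    then have "finite N" "x \<notin> N" using insert finite_subset by auto
    then show "of_bool (odd (card (insert x N)) \<longleftrightarrow> b) = (of_bool (odd (card N) \<longleftrightarrow> \<not> b) :: real)" by auto
  qed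
  then have "rexp (insert x D) (\<lambda>_. p) (\<lambda>N. of_bool (odd (card N) \<longleftrightarrow> b))
      = p * ((1 + (if \<not> b then -1 else 1) * (1 - 2 * p) ^ card D) / 2)
      + (1 - p) * ((1 + (if b then -1 else 1) * (1 - 2 * p) ^ card D) / 2)"
    by (simp only: rexp_insert[OF insert.hyps(1,2)] insert.IH)
  also have "\<dots> = (1 + (if b then -1 else 1) * (1 - 2 * p) ^ card (insert x D)) / 2"
    using insert.hyps by (cases b) (simp_all add: field_simps)
  finally show ?case .
qed (auto simp: rexp_def)

lemma oddnb_star:
  "oddnb ((\<lambda>u. {u, h}) ` N \<union> E) h D \<longleftrightarrow> odd (card (N \<inter> D))"
  if "\<And>u. u \<in> D \<Longrightarrow> {u, h} \<notin> E"
proof -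
  have "{u \<in> D. {u, h} \<in> (\<lambda>u. {u, h}) ` N \<union> E} = N \<inter> D"
    using that by (auto simp: doubleton_eq_iff)
  then show ?thesis by (simp add: oddnb_def)
qed

text \<open>The parities at different vertices of \<open>J\<close> use disjoint sets of edges, hence
  are independent, each off from 1/2 by at most half of
  \<open>\<bar>1 - 2 * p\<bar> ^ card D\<close>.\<close>

lemma rexp_parity_vector:
  assumes "finite D" "finite J" "D \<inter> J = {}" "t \<subseteq> J" "0 \<le> p" "p \<le> 1"
  shows "\<bar>rexp ((\<lambda>(q, h). {q, h}) ` (D \<times> J)) (\<lambda>_. p) (\<lambda>E. of_bool ({h \<in> J. oddnb E h D} = t))
    - (1/2) ^ card J\<bar> \<le> \<bar>1 - 2 * p\<bar> ^ card D"
  using assms(2,1,3-)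
proof (induction J arbitrary: t)
  case empty
  then show ?case by simp
next
  case (insert h J)
  let ?G = "\<lambda>J. (\<lambda>(q, h). {q, h}) ` (D \<times> J)"
  let ?s = "\<lambda>u. {u, h}"
  let ?f = "\<lambda>J t E. of_bool ({h \<in> J. oddnb E h D} = t) :: real"
  let ?r = "rexp (?G J) (\<lambda>_. p) (?f J (t - {h}))"
  let ?\<epsilon> = "(if h \<in> t then -1 else 1) * (1 - 2 * p) ^ card D"
  have G: "?G (insert h J) = ?s ` D \<union> ?G J" "?s ` D \<inter> ?G J = {}"
    using insert.hyps insert.prems by (auto simp: doubleton_eq_iff)
  have "rexp (?G (insert h J)) (\<lambda>_. p) (?f (insert h J) t)
    = rexp (?s ` D) (\<lambda>_. p) (\<lambda>E. rexp (?G J) (\<lambda>_. p) (\<lambda>E'. ?f (insert h J) t (E \<union> E')))"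
    unfolding G(1) using G(2) insert.hyps insert.prems by (intro rexp_Un) auto
  also have "\<dots> = rexp D (\<lambda>_. p) (\<lambda>N. rexp (?G J) (\<lambda>_. p) (\<lambda>E'. ?f (insert h J) t (?s ` N \<union> E')))"
    using insert.prems by (intro rexp_image inj_on_star)
  also have "\<dots> = rexp D (\<lambda>_. p) (\<lambda>N. rexp (?G J) (\<lambda>_. p)
      (\<lambda>E'. of_bool (odd (card N) \<longleftrightarrow> h \<in> t) * ?f J (t - {h}) E'))"
  proof (intro rexp_cong refl)
    fix N E' assume N: "N \<subseteq> D" and E': "E' \<subseteq> ?G J"
    have "{u, h} \<notin> E'" if "u \<in> D" for u using that E' insert.hyps insert.prems
      by (auto simp: doubleton_eq_iff)
    then have 1: "oddnb (?s ` N \<union> E') h D \<longleftrightarrow> odd (card N)"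
      using N by (simp add: oddnb_star Int_absorb2)
    have 2: "oddnb (?s ` N \<union> E') h' D \<longleftrightarrow> oddnb E' h' D" if "h' \<in> J" for h'
      using that N insert.hyps insert.prems by (intro oddnb_cong) (auto simp: doubleton_eq_iff)
    have "{h' \<in> insert h J. oddnb (?s ` N \<union> E') h' D}
       = (if odd (card N) then {h} else {}) \<union> {h' \<in> J. oddnb E' h' D}"
      using 1 2 by auto
    moreover have "(if odd (card N) then {h} else {}) \<union> {h' \<in> J. oddnb E' h' D} = t
       \<longleftrightarrow> (odd (card N) \<longleftrightarrow> h \<in> t) \<and> {h' \<in> J. oddnb E' h' D} = t - {h}"
      using insert.hyps by (auto split: if_splits)
    ultimately show "?f (insert h J) t (?s ` N \<union> E') = of_bool (odd (card N) \<longleftrightarrow> h \<in> t) * ?f J (t - {h}) E'"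
      by simp
  qed
  also have "\<dots> = (1 + ?\<epsilon>) / 2 * ?r"
    using insert.prems by (simp only: rexp_cmult rexp_multc rexp_parity)
  finally have eq: "rexp (?G (insert h J)) (\<lambda>_. p) (?f (insert h J) t) = (1 + ?\<epsilon>) / 2 * ?r" .
  have IH: "\<bar>?r - (1/2) ^ card J\<bar> \<le> \<bar>1 - 2 * p\<bar> ^ card D"
    using insert by (intro insert.IH) auto
  have r: "0 \<le> ?r" "?r \<le> 1"
    using insert.hyps insert.prems by (auto intro!: rexp_nonneg rexp_le)
  \<comment> \<open>One more vertex halves the old error and adds at most half of the bias, so the
    bound does not grow with \<open>card J\<close>.\<close>
  have "\<bar>(1 + ?\<epsilon>) / 2 * ?r - (1/2) ^ card (insert h J)\<bar> = \<bar>(?r - (1/2) ^ card J) / 2 + ?\<epsilon> * ?r / 2\<bar>"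
    using insert.hyps by (simp add: field_simps)
  also have "\<dots> \<le> \<bar>?r - (1/2) ^ card J\<bar> / 2 + \<bar>?\<epsilon>\<bar> * ?r / 2"
    using r by (intro order_trans[OF abs_triangle_ineq]) (simp add: abs_mult)
  also have "\<dots> \<le> \<bar>1 - 2 * p\<bar> ^ card D / 2 + \<bar>1 - 2 * p\<bar> ^ card D * 1 / 2"
    using IH r by (intro add_mono divide_right_mono mult_mono) (auto simp: abs_mult power_abs)
  finally show ?case unfolding eq by simp
qed

text \<open>A sum over the booleans, so that the averages over the bits of \<open>q\<close> can be
  moved inside the other expectations.\<close>

lemma rexp_insert_half:
  assumes "finite A" "q \<notin> A"
  shows "rexp (insert q A) (\<lambda>_. 1/2) g
    = (\<Sum>b\<in>UNIV. 1/2 * rexp A (\<lambda>_. 1/2) (\<lambda>d. g (if b then insert q d else d)))"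
  using assms by (simp add: rexp_insert UNIV_bool)

text \<open>Each vertex enters both \<open>P\<close> for \<open>w\<close> and \<open>Q\<close> for \<open>w'\<close> with probability at least \<open>\<delta> ^ 8 / 8\<close>: it
  suffices that its number of neighbours is even in \<open>S \<union> P\<close>, in \<open>S \<union> P'\<close> and in the symmetric
  difference of \<open>Q\<close> and \<open>Q'\<close>, and that its three uniform bits are right.\<close>

lemma sweep_pair:
  assumes \<delta>: "0 < \<delta>" "\<delta> \<le> p" "p \<le> 1 - \<delta>" and l: "0 \<le> l" "l \<le> 1"
    and S: "finite S" "distinct qs" "S \<inter> set qs = {}"
  shows "rexp (set qs) (\<lambda>_. 1/2) (\<lambda>d. rexp (set qs) (\<lambda>_. 1/2) (\<lambda>w. rexp (set qs) (\<lambda>_. 1/2) (\<lambda>w'.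
      rexp (nsets (S \<union> set qs) 2) (\<lambda>_. p)
        (\<lambda>E. l ^ card (fst (sweep E d S w qs) \<inter> snd (sweep E d S w' qs))))))
    \<le> (1 - \<delta> ^ 8 * (1 - l) / 8) ^ length qs"
  using S(2,3)
proof (induction qs)
  case Nil
  then show ?case using S(1) by (simp add: finite_imp_finite_nsets)
next
  case (Cons q qs)
  let ?A = "set qs" and ?Y = "S \<union> set qs"
  let ?F = "nsets ?Y 2" and ?s = "\<lambda>u. {u, q}"
  let ?h = "\<lambda>qs d w w' E. l ^ card (fst (sweep E d S w qs) \<inter> snd (sweep E d S w' qs))"
  let ?i = "\<lambda>b d. if b then insert q d else d"
  let ?r = "1 - \<delta> ^ 8 * (1 - l) / 8"
  have A: "finite ?A" "q \<notin> ?A" and Y: "q \<notin> ?Y" "finite ?Y" "finite ?F"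
    using Cons.prems S by (auto simp: finite_imp_finite_nsets)
  have F: "nsets (S \<union> set (q # qs)) 2 = ?F \<union> ?s ` ?Y" "?F \<inter> ?s ` ?Y = {}"
    using nsets2_insert[OF Y(1)] star_disjoint[OF Y(1), of ?Y] by (simp_all add: Un_commute Int_commute)
  have F': "rexp (nsets (S \<union> set (q # qs)) 2) (\<lambda>_. p) g
      = rexp ?F (\<lambda>_. p) (\<lambda>E. rexp ?Y (\<lambda>_. p) (\<lambda>N. g (?s ` N \<union> E)))" for g
    unfolding F(1) using F(2) Y
    by (subst rexp_Un) (auto simp: rexp_image[OF _ inj_on_star] Un_commute)
  have r: "0 \<le> ?r"
    using \<delta> l mult_mono[of "\<delta> ^ 8" 1 "1 - l" 1] by (simp add: power_le_one)
  have "rexp (set (q # qs)) (\<lambda>_. 1/2) (\<lambda>d. rexp (set (q # qs)) (\<lambda>_. 1/2) (\<lambda>w.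
      rexp (set (q # qs)) (\<lambda>_. 1/2) (\<lambda>w'. rexp (nsets (S \<union> set (q # qs)) 2) (\<lambda>_. p) (?h (q # qs) d w w'))))
    = rexp ?A (\<lambda>_. 1/2) (\<lambda>d. rexp ?A (\<lambda>_. 1/2) (\<lambda>w. rexp ?A (\<lambda>_. 1/2) (\<lambda>w'. rexp ?F (\<lambda>_. p)
        (\<lambda>E. rexp ?Y (\<lambda>_. p) (\<lambda>N. \<Sum>x\<in>UNIV. 1/2 * (\<Sum>y\<in>UNIV. 1/2 * (\<Sum>z\<in>UNIV. 1/2 *
           ?h (q # qs) (?i x d) (?i y w) (?i z w') (?s ` N \<union> E))))))))"
    unfolding F'[unfolded list.set(2)] list.set(2) rexp_insert_half[OF A] by (simp only: rexp_sum rexp_cmult)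
  also have "\<dots> \<le> rexp ?A (\<lambda>_. 1/2) (\<lambda>d. rexp ?A (\<lambda>_. 1/2) (\<lambda>w. rexp ?A (\<lambda>_. 1/2) (\<lambda>w'. rexp ?F (\<lambda>_. p)
        (\<lambda>E. ?r * ?h qs d w w' E))))"
  proof (intro rexp_mono)
    fix d w w' E
    assume sub: "d \<subseteq> ?A" "w \<subseteq> ?A" "w' \<subseteq> ?A" and E: "E \<subseteq> ?F"
    obtain P Q where PQ: "sweep E d S w qs = (P, Q)" by fastforce
    obtain P' Q' where PQ': "sweep E d S w' qs = (P', Q')" by fastforce
    have sPQ: "P \<subseteq> ?A" "Q \<subseteq> ?A" "P' \<subseteq> ?A" "Q' \<subseteq> ?A"
      using sweep_subset[OF PQ] sweep_subset[OF PQ'] by auto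
    let ?As = "[S \<union> P, S \<union> P', sym_diff Q Q']"
    let ?c = "\<lambda>N. even (card N) \<and> (\<forall>A\<in>set ?As. even (card (N \<inter> A)))"
    let ?t = "l ^ card (P \<inter> Q')"
    let ?g = "\<lambda>N x y z. ?h (q # qs) (?i x d) (?i y w) (?i z w') (?s ` N \<union> E)"
    have t: "0 \<le> ?t" using l by simp
    have bound: "(\<Sum>x\<in>UNIV. 1/2 * (\<Sum>y\<in>UNIV. 1/2 * (\<Sum>z\<in>UNIV. 1/2 * ?g N x y z)))
        \<le> ?t - of_bool (?c N) * ((1 - l) / 8 * ?t)" if N: "N \<subseteq> ?Y" for N
    proof -
      have odd: "oddnb (?s ` N \<union> E) q D \<longleftrightarrow> odd (card (N \<inter> D))" if "D \<subseteq> ?Y" for D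
        using that E Y by (intro oddnb_star) auto
      have edge: "{u, v} \<in> E \<longleftrightarrow> {u, v} \<in> ?s ` N \<union> E" if "u \<in> ?Y" "v \<in> ?Y" for u v
        using that Y by (auto simp: doubleton_eq_iff)
      \<comment> \<open>The tail is processed before \<open>q\<close>, so its outcome depends
        neither on the edges at \<open>q\<close> nor on the bits of \<open>q\<close>.\<close>
      have ps: "sweep (?s ` N \<union> E) (?i x d) S (?i y w) qs = (P, Q)" for x y
      proof (rule sweep_cong[OF PQ])
        show "{u, v} \<in> E \<longleftrightarrow> {u, v} \<in> ?s ` N \<union> E" if "v \<in> ?A" "u \<in> S \<union> P \<union> Q" for u v
          using that sPQ by (intro edge) auto
      qed (use A in auto)
      have ps': "sweep (?s ` N \<union> E) (?i x d) S (?i y w') qs = (P', Q')" for x y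
      proof (rule sweep_cong[OF PQ'])
        show "{u, v} \<in> E \<longleftrightarrow> {u, v} \<in> ?s ` N \<union> E" if "v \<in> ?A" "u \<in> S \<union> P' \<union> Q'" for u v
          using that sPQ by (intro edge) auto
      qed (use A in auto)
      have le: "?g N x y z \<le> ?t" for x y z
      proof -
        obtain P1 Q1 where 1: "sweep (?s ` N \<union> E) (?i x d) S (?i y w) (q # qs) = (P1, Q1)" by fastforce
        obtain P2 Q2 where 2: "sweep (?s ` N \<union> E) (?i x d) S (?i z w') (q # qs) = (P2, Q2)" by fastforce
        have "P \<subseteq> P1" using 1 ps[of x y] by (auto split: if_splits)
        moreover have "Q' \<subseteq> Q2" using 2 ps'[of x z] by (auto split: if_splits)
        moreover have "finite P1" "finite Q2"
          using sweep_subset[OF 1] sweep_subset[OF 2] by (auto intro: finite_subset)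
        ultimately have "card (P \<inter> Q') \<le> card (P1 \<inter> Q2)" by (intro card_mono) auto
        then show ?thesis unfolding 1 2 using l by (simp add: power_decreasing)
      qed
      define G where "G x y z = ?g N x y z" for x y z
      define T where "T = ?t"
      have leG: "G x y z \<le> T" for x y z unfolding G_def T_def by (rule le)
      have "(\<Sum>x\<in>UNIV. 1/2 * (\<Sum>y\<in>UNIV. 1/2 * (\<Sum>z\<in>UNIV. 1/2 * G x y z)))
        \<le> T - of_bool (?c N) * ((1 - l) / 8 * T)"
      proof (cases "?c N")
        case False
        have "(\<Sum>x\<in>UNIV. 1/2 * (\<Sum>y\<in>UNIV. 1/2 * (\<Sum>z\<in>UNIV. 1/2 * G x y z)))
          \<le> (\<Sum>x\<in>(UNIV :: bool set). 1/2 * (\<Sum>y\<in>(UNIV :: bool set). 1/2 * (\<Sum>z\<in>(UNIV :: bool set). 1/2 * T)))"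
          by (intro sum_mono mult_left_mono leG) auto
        also have "\<dots> = T" by (simp add: UNIV_bool)
        also have "\<dots> = T - of_bool (?c N) * ((1 - l) / 8 * T)"
          unfolding of_bool_def if_not_P[OF False] by simp
        finally show ?thesis .
      next
        case True
        let ?x = "odd (card (N \<inter> Q))"
        have finN: "finite N" using N Y finite_subset by auto
        have "card (N \<inter> sym_diff Q Q') + 2 * card (N \<inter> (Q \<inter> Q')) = card (N \<inter> Q) + card (N \<inter> Q')"
        proof -
          have a: "card (N \<inter> Q) = card (N \<inter> (Q - Q')) + card (N \<inter> (Q \<inter> Q'))"
            using finN by (subst card_Un_disjoint[symmetric]) (auto intro: arg_cong[where f = card])
          have b: "card (N \<inter> Q') = card (N \<inter> (Q' - Q)) + card (N \<inter> (Q \<inter> Q'))"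
            using finN by (subst card_Un_disjoint[symmetric]) (auto intro: arg_cong[where f = card])
          have c: "card (N \<inter> sym_diff Q Q') = card (N \<inter> (Q - Q')) + card (N \<inter> (Q' - Q))"
            using finN by (subst card_Un_disjoint[symmetric]) (auto intro: arg_cong[where f = card])
          show ?thesis using a b c by simp
        qed
        moreover have "even (card (N \<inter> sym_diff Q Q'))" using True by simp
        \<comment> \<open>Evenness on the symmetric difference gives \<open>q\<close> the same
          parity into \<open>Q\<close> and into \<open>Q'\<close>, so one value of the shared bit in
          \<open>d\<close> admits \<open>q\<close> in both runs.\<close>
        ultimately have par: "odd (card (N \<inter> Q')) \<longleftrightarrow> ?x" by presburger
        have dq: "q \<in> ?i ?x d \<longleftrightarrow> ?x" and wq: "q \<in> ?i True w" "q \<notin> ?i False w'" using sub A by auto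
        have "sweep (?s ` N \<union> E) (?i ?x d) S (?i True w) (q # qs) = (insert q P, Q)"
          unfolding sweep.simps ps using True dq wq sPQ odd[of "S \<union> P"] odd[of Q] by auto
        moreover have "sweep (?s ` N \<union> E) (?i ?x d) S (?i False w') (q # qs) = (P', insert q Q')"
          unfolding sweep.simps ps' using True dq wq sPQ par odd[of "S \<union> P'"] odd[of Q'] by auto
        moreover have "card (insert q P \<inter> insert q Q') = Suc (card (P \<inter> Q'))"
        proof -
          have "finite (P \<inter> Q')" "q \<notin> P \<inter> Q'"
            using finite_subset[OF sPQ(1) A(1)] sPQ A by auto
          moreover have "insert q P \<inter> insert q Q' = insert q (P \<inter> Q')" by auto
          ultimately show ?thesis by simp
        qed
        ultimately have g: "G ?x True False = l * T" by (simp add: G_def T_def)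
        \<comment> \<open>One of the eight choices of the three bits puts \<open>q\<close> into both
          sets and gains the factor \<open>l\<close>.\<close>
        have "(\<Sum>x\<in>UNIV. 1/2 * (\<Sum>y\<in>UNIV. 1/2 * (\<Sum>z\<in>UNIV. 1/2 * G x y z)))
          \<le> (\<Sum>x\<in>UNIV. 1/2 * (\<Sum>y\<in>UNIV. 1/2 * (\<Sum>z\<in>UNIV. 1/2 *
              (if x = ?x \<and> y \<and> \<not> z then l * T else T))))"
          using leG g by (intro sum_mono mult_left_mono) auto
        also have "\<dots> = T - (1 - l) / 8 * T"
          by (cases ?x) (auto simp: UNIV_bool field_simps)
        also have "\<dots> = T - of_bool (?c N) * ((1 - l) / 8 * T)"
          unfolding of_bool_def if_P[OF True] by simp
        finally show ?thesis .
      qed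
      then show ?thesis unfolding G_def T_def .
    qed
    have "rexp ?Y (\<lambda>_. p) (\<lambda>N. \<Sum>x\<in>UNIV. 1/2 * (\<Sum>y\<in>UNIV. 1/2 * (\<Sum>z\<in>UNIV. 1/2 * ?g N x y z)))
        \<le> rexp ?Y (\<lambda>_. p) (\<lambda>N. ?t - of_bool (?c N) * ((1 - l) / 8 * ?t))"
      using \<delta> bound by (intro rexp_mono) auto
    also have "\<dots> = ?t - rexp ?Y (\<lambda>_. p) (\<lambda>N. of_bool (?c N)) * ((1 - l) / 8 * ?t)"
      using Y by (simp only: rexp_diff rexp_const rexp_multc)
    \<comment> \<open>Three sets in \<open>?As\<close> give the exponent
      \<open>2 ^ 3 = 8\<close>.\<close>
    also have "\<dots> \<le> ?t - \<delta> ^ 8 * ((1 - l) / 8 * ?t)"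
      using rexp_all_even_ge[OF Y(2) \<delta>, of ?As] t l
      by (intro diff_left_mono mult_right_mono) auto
    also have "\<dots> = ?r * ?h qs d w w' E" by (simp add: PQ PQ' algebra_simps)
    finally show "rexp ?Y (\<lambda>_. p) (\<lambda>N. \<Sum>x\<in>UNIV. 1/2 * (\<Sum>y\<in>UNIV. 1/2 * (\<Sum>z\<in>UNIV. 1/2 *
           ?h (q # qs) (?i x d) (?i y w) (?i z w') (?s ` N \<union> E)))) \<le> ?r * ?h qs d w w' E" .
  qed (use \<delta> in auto)
  also have "\<dots> = ?r * rexp ?A (\<lambda>_. 1/2) (\<lambda>d. rexp ?A (\<lambda>_. 1/2) (\<lambda>w. rexp ?A (\<lambda>_. 1/2) (\<lambda>w'.
      rexp ?F (\<lambda>_. p) (?h qs d w w'))))"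
    by (simp only: rexp_cmult)
  also have "\<dots> \<le> ?r * ?r ^ length qs"
    using Cons r by (intro mult_left_mono) auto
  finally show ?case by simp
qed

section \<open>The second moment argument\<close>

text \<open>The list \<open>qs\<close> holds the vertices whose edges to \<open>r\<close> are
  uniform pads; vertices outside \<open>{a, b, r}\<close>, \<open>qs\<close> and \<open>J\<close>
  simply stay in the middle. The pairs in \<open>F\<close> avoid \<open>r\<close>: during the sweep
  the pads enter only through the set \<open>d\<close> of odd degrees.\<close>

locale parity_setup =
  fixes V :: "'a set" and a b r :: 'a and qs :: "'a list" and J :: "'a set" and p \<delta> :: real
  assumes finV: "finite V" and ends: "a \<in> V" "b \<in> V" "r \<in> V" "a \<noteq> b" "a \<noteq> r" "b \<noteq> r"
    and qs: "distinct qs" "set qs \<subseteq> V - {a, b, r} - J"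
    and J: "J \<subseteq> V - {a, b, r}" "J \<noteq> {}"
    and \<delta>: "0 < \<delta>" "\<delta> \<le> p" "p \<le> 1 - \<delta>"
begin

abbreviation "S \<equiv> {a, b}"
abbreviation "A \<equiv> set qs"
abbreviation "F \<equiv> nsets (V - {r}) 2"
abbreviation "sw E d w \<equiv> sweep E d S w qs"

definition "mid E d w = V - (S \<union> {r} \<union> fst (sw E d w) \<union> snd (sw E d w))"
definition "bits E d w = {v \<in> mid E d w. oddnb E v (S \<union> fst (sw E d w))}"
definition "reachable E d w \<longleftrightarrow> grow E J (bits E d w) {} (mid E d w)"
text \<open>A parity vector on \<open>J\<close> that lets the middle be built without free vertices.
  It is chosen from the middle and the bits outside \<open>J\<close> alone, hence does not react to
  the edges between \<open>J\<close> and the bottom.\<close>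

definition "target E d w = (SOME t. t \<subseteq> J \<and> grow E {} ((bits E d w - J) \<union> t) {} (mid E d w))"
definition "hit E d w \<longleftrightarrow> reachable E d w \<and> bits E d w \<inter> J = target E d w"

lemma target:
  assumes "reachable E d w"
  shows "target E d w \<subseteq> J" "grow E {} ((bits E d w - J) \<union> target E d w) {} (mid E d w)"
  using someI_ex[OF grow_target[OF assms[unfolded reachable_def]]] unfolding target_def by auto

lemma J_fin: "finite J"
  using J finV finite_subset by blast

lemma F_fin: "finite F"
  using finV by (simp add: finite_imp_finite_nsets)

lemma p01: "0 \<le> p" "p \<le> 1"
  using \<delta> by auto

lemma sw_sub:
  assumes "sw E d w = (P, Q)"
  shows "P \<subseteq> A" "Q \<subseteq> A" "P \<inter> Q = {}" "finite P" "finite Q"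
    "mid E d w = V - (S \<union> {r} \<union> P \<union> Q)" "J \<subseteq> mid E d w"
  using sweep_subset[OF assms] sweep_disjoint[OF assms qs(1)] finite_subset[of _ A] qs J assms
  by (auto simp: mid_def)

text \<open>The construction goes from \<open>{a, b}\<close> through the bottom \<open>P\<close>,
  the middle, \<open>r\<close> and finally the top \<open>Q\<close>. A hit makes the prescribed bits
  on \<open>J\<close> the true ones.\<close>

lemma hit_imp_grow:
  assumes E0: "E0 \<subseteq> F" and R: "R \<subseteq> V - {r}" and E: "E = E0 \<union> (\<lambda>u. {u, r}) ` R"
    and d: "\<And>q. q \<in> A \<Longrightarrow> q \<in> d \<longleftrightarrow> oddnb E q V"
    and even: "even (card E) \<longleftrightarrow> {a, b} \<notin> E" and hit: "hit E0 d w"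
  shows "grow E {} {} S V"
proof -
  obtain P Q where PQ: "sw E0 d w = (P, Q)" by fastforce
  note sub = sw_sub[OF PQ]
  define M where "M = mid E0 d w"
  have M: "M = V - (S \<union> {r} \<union> P \<union> Q)" using sub by (simp add: M_def)
  have edge: "{u, v} \<in> E0 \<longleftrightarrow> {u, v} \<in> E" if "u \<noteq> r" "v \<noteq> r" for u v
    using that E by (auto simp: doubleton_eq_iff)
  have PQE: "sweep E d S w qs = (P, Q)"
    using sub(1,2) qs(2) ends by (intro sweep_cong[OF PQ] edge) auto
  have reach: "reachable E0 d w" and bits: "bits E0 d w \<inter> J = target E0 d w"
    using hit by (auto simp: hit_def)
  have "(bits E0 d w - J) \<union> target E0 d w = bits E0 d w" using bits by auto
  then have "grow E0 {} (bits E0 d w) {} M" using target(2)[OF reach] by (simp add: M_def)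
  then have "grow E {} (bits E0 d w) {} M"
  proof (rule grow_cong)
    show "e \<in> E0 \<longleftrightarrow> e \<in> E" if "e \<in> nsets M 2" for e
      using that M edge by (auto simp: nsets_2_eq)
  qed auto
  then have "grow E {} {} (S \<union> P) (S \<union> P \<union> M)"
  proof (rule grow_shift)
    show "v \<in> bits E0 d w \<longleftrightarrow> oddnb E v (S \<union> P)" if "v \<in> M" for v
    proof -
      have "oddnb E0 v (S \<union> P) \<longleftrightarrow> oddnb E v (S \<union> P)"
        using that M sub(1) qs(2) ends by (intro oddnb_cong edge) auto
      then show ?thesis using that PQ by (simp add: bits_def M_def)
    qed
  qed (use M sub in auto)
  from grow_trans[OF this sweep_bottom[OF PQE qs(1)]] qs
  have "grow E {} {} S (S \<union> P \<union> M)" by blast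
  moreover have "S \<union> P \<union> M = V - Q - {r}" using M sub qs ends by blast
  ultimately have g1: "grow E {} {} S (V - Q - {r})" by simp
  have EV: "E \<subseteq> nsets V 2"
    using E0 R E ends nsets_mono[of "V - {r}" V 2] by auto
  have g2: "grow E {} {} (V - Q) V"
    using finV qs EV d by (intro sweep_top[OF PQE]) auto
  have fin: "finite (V - Q)" "finite (V - Q - {r})" using finV by auto
  have "E \<inter> nsets V 2 = E" using EV by auto
  then have "even (card (E \<inter> nsets (V - Q) 2)) \<longleftrightarrow> {a, b} \<notin> E"
    using grow_parity[OF g2 fin(1)] even by simp
  moreover have "even (card (E \<inter> nsets (V - Q - {r}) 2)) \<longleftrightarrow> {a, b} \<notin> E"
    using grow_parity[OF g1] ends by (cases "{a, b} \<in> E") auto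
  moreover have ins: "insert r (V - Q - {r}) = V - Q" using ends sub qs by auto
  \<comment> \<open>Just below and just above \<open>r\<close> the number of edges has the parity
    prescribed by \<open>{a, b}\<close>, so \<open>r\<close> brings in an even number.\<close>
  ultimately have "\<not> oddnb E r (V - Q - {r})"
    using even_edges_insert[OF fin(2), of r E] by auto
  then have "grow E {} {} S (insert r (V - Q - {r}))"
    using g1 by (intro grow.step) auto
  then show ?thesis using grow_trans[OF g2] ins by simp
qed

text \<open>The edges between \<open>J\<close> and the bottom may differ: they change the bits on
  \<open>J\<close> only, hence possibly \<open>hit\<close>, but neither \<open>reachable\<close> nor
  \<open>target\<close>.\<close>

lemma core_cong:
  assumes PQ: "sw E d w = (P, Q)"
    and sw: "\<And>q u. q \<in> A \<Longrightarrow> u \<in> S \<union> P \<union> Q \<Longrightarrow> {u, q} \<in> E \<longleftrightarrow> {u, q} \<in> E'"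
    and m: "\<And>e. e \<in> nsets (V - (S \<union> {r} \<union> P \<union> Q)) 2 \<Longrightarrow> e \<in> E \<longleftrightarrow> e \<in> E'"
    and s: "\<And>v u. v \<in> V - (S \<union> {r} \<union> P \<union> Q) - J \<Longrightarrow> u \<in> S \<union> P \<Longrightarrow> {u, v} \<in> E \<longleftrightarrow> {u, v} \<in> E'"
  shows "sw E' d w = (P, Q)" "mid E' d w = mid E d w" "reachable E' d w \<longleftrightarrow> reachable E d w"
    "target E' d w = target E d w"
proof -
  let ?M = "V - (S \<union> {r} \<union> P \<union> Q)"
  show PQ': "sw E' d w = (P, Q)" using sw by (intro sweep_cong[OF PQ]) auto
  have M: "mid E d w = ?M" "mid E' d w = ?M" using sw_sub(6)[OF PQ] sw_sub(6)[OF PQ'] by auto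
  then show "mid E' d w = mid E d w" by simp
  have "oddnb E v (S \<union> P) \<longleftrightarrow> oddnb E' v (S \<union> P)" if "v \<in> ?M - J" for v
    using s that by (intro oddnb_cong) auto
  then have B: "bits E d w - J = bits E' d w - J"
    unfolding bits_def M PQ PQ' by auto
  have g: "grow E J1 B1 {} ?M \<longleftrightarrow> grow E' J1 B2 {} ?M" if "B1 - J1 = B2 - J1" for J1 B1 B2
    using m that grow_cong[of E J1 B1 "{}" ?M E' J1 B2] grow_cong[of E' J1 B2 "{}" ?M E J1 B1] by auto
  show "reachable E' d w \<longleftrightarrow> reachable E d w"
    unfolding reachable_def M using g[OF B] by simp
  show "target E' d w = target E d w"
    unfolding target_def M B using g[of "_" "{}", OF refl] by simp
qed

text \<open>The sweep never inspects an edge inside the middle, so conditioning on its outcome leaves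
  these edges independent.\<close>

lemma rexp_not_reachable:
  assumes k: "0 < \<kappa>" "\<kappa> < 1" and pk: "1 - \<kappa>\<^sup>2 \<le> p" "p \<le> \<kappa>\<^sup>2"
  shows "rexp F (\<lambda>_. p) (\<lambda>E. of_bool (\<not> reachable E d w)) \<le> \<kappa> ^ (card J - 1) * exp (1 / (1 - \<kappa>)\<^sup>2)"
    (is "_ \<le> ?b")
proof -
  \<comment> \<open>The expectation is split according to the outcome \<open>x = (P, Q)\<close> of
    the sweep.\<close>
  let ?I = "Pow A \<times> Pow A"
  let ?i = "\<lambda>x E. of_bool (sw E d w = x) :: real"
  have sum1: "(\<Sum>x\<in>?I. ?i x E) = 1" for E
  proof -
    have "sw E d w \<in> ?I" using sweep_subset[of E d S w qs] by (cases "sw E d w") auto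
    then show ?thesis by (subst sum.cong[OF refl, of _ _ "\<lambda>x. if sw E d w = x then 1 else 0"]) auto
  qed
  have b0: "0 \<le> ?b" using k by simp
  have main: "rexp F (\<lambda>_. p) (\<lambda>E. ?i x E * of_bool (\<not> reachable E d w)) \<le> rexp F (\<lambda>_. p) (\<lambda>E. ?i x E * ?b)"
    if x: "x \<in> ?I" for x
  proof -
    obtain P Q where x': "x = (P, Q)" "P \<subseteq> A" "Q \<subseteq> A" using x by auto
    define M where "M = V - (S \<union> {r} \<union> P \<union> Q)"
    \<comment> \<open>The pairs in \<open>H\<close> are exposed first. They decide whether the
      outcome is \<open>x\<close> and then fix the bits, while the pairs inside \<open>M\<close>
      stay fresh.\<close>
    define H where "H = F - nsets M 2"
    have JM: "J \<subseteq> M" "finite M" using J qs x' finV by (auto simp: M_def)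
    have F: "F = H \<union> nsets M 2" "H \<inter> nsets M 2 = {}" "finite H" "finite (nsets M 2)"
      using F_fin nsets_mono[of M "V - {r}" 2] JM by (auto simp: H_def M_def finite_imp_finite_nsets)
    have split: "rexp F (\<lambda>_. p) g = rexp H (\<lambda>_. p) (\<lambda>E1. rexp (nsets M 2) (\<lambda>_. p) (\<lambda>E2. g (E1 \<union> E2)))" for g
      unfolding F(1) using F(2-) by (intro rexp_Un)
    have "rexp (nsets M 2) (\<lambda>_. p) (\<lambda>E2. ?i x (E1 \<union> E2) * of_bool (\<not> reachable (E1 \<union> E2) d w))
      \<le> rexp (nsets M 2) (\<lambda>_. p) (\<lambda>E2. ?i x (E1 \<union> E2) * ?b)" if E1: "E1 \<subseteq> H" for E1
    proof -
      have edge: "{u, v} \<in> E1 \<union> E2 \<longleftrightarrow> {u, v} \<in> E1" if "E2 \<subseteq> nsets M 2" "u \<notin> M" for u v E2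
        using that by auto
      have i: "?i x (E1 \<union> E2) = ?i x E1" if "E2 \<subseteq> nsets M 2" for E2
      proof -
        have *: "{u, q} \<in> E1 \<union> E2 \<longleftrightarrow> {u, q} \<in> E1" if "u \<in> S \<union> P \<union> Q" for u q
          using that \<open>E2 \<subseteq> nsets M 2\<close> by (intro edge) (auto simp: M_def)
        have "sw (E1 \<union> E2) d w = x \<longleftrightarrow> sw E1 d w = x"
          unfolding x' using * sweep_cong[of E1 d S w qs P Q "E1 \<union> E2" d w]
            sweep_cong[of "E1 \<union> E2" d S w qs P Q E1 d w] by blast
        then show ?thesis by simp
      qed
      show ?thesis
      proof (cases "sw E1 d w = x")
        case False
        then have "?i x (E1 \<union> E2) = 0" if "E2 \<subseteq> nsets M 2" for E2 using i[OF that] by simp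
        then show ?thesis using p01 b0 by (intro rexp_mono) auto
      next
        case True
        define B where "B = {v \<in> M. oddnb E1 v (S \<union> P)}"
        have reach: "reachable (E1 \<union> E2) d w \<longleftrightarrow> grow E2 J B {} M" if E2: "E2 \<subseteq> nsets M 2" for E2
        proof -
          have PQ: "sw (E1 \<union> E2) d w = (P, Q)" using i[OF E2] True x' by (auto split: if_splits)
          have mid: "mid (E1 \<union> E2) d w = M" using sw_sub(6)[OF PQ] by (simp add: M_def)
          have "oddnb (E1 \<union> E2) v (S \<union> P) \<longleftrightarrow> oddnb E1 v (S \<union> P)" for v
            using E2 by (intro oddnb_cong edge) (auto simp: M_def)
          then have "bits (E1 \<union> E2) d w = B" unfolding bits_def mid PQ B_def by simp
          moreover have "e \<in> E1 \<union> E2 \<longleftrightarrow> e \<in> E2" if "e \<in> nsets M 2" for e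
            using that E1 by (auto simp: H_def)
          then have "grow (E1 \<union> E2) J B {} M \<longleftrightarrow> grow E2 J B {} M"
            using grow_cong[of "E1 \<union> E2" J B "{}" M E2 J B] grow_cong[of E2 J B "{}" M "E1 \<union> E2" J B]
            by auto
          ultimately show ?thesis unfolding reachable_def mid by simp
        qed
        have MJ: "M - J \<union> J = M" using JM by auto
        have "rexp (nsets M 2) (\<lambda>_. p) (\<lambda>E2. ?i x (E1 \<union> E2) * of_bool (\<not> reachable (E1 \<union> E2) d w))
            = rexp (nsets M 2) (\<lambda>_. p) (\<lambda>E2. of_bool (\<not> grow E2 J B {} M))"
          using i reach True by (intro rexp_cong) auto
        also have "\<dots> \<le> ?b"
          using grow_random[OF k pk, of "M - J" J B] JM J_fin J(2) unfolding MJ by auto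
        also have "\<dots> = rexp (nsets M 2) (\<lambda>_. p) (\<lambda>E2. ?b)" using F by simp
        also have "\<dots> = rexp (nsets M 2) (\<lambda>_. p) (\<lambda>E2. ?i x (E1 \<union> E2) * ?b)"
          using i True by (intro rexp_cong) auto
        finally show ?thesis .
      qed
    qed
    then show ?thesis unfolding split by (intro rexp_mono[of H]) (use p01 in auto)
  qed
  have "rexp F (\<lambda>_. p) (\<lambda>E. of_bool (\<not> reachable E d w))
      = rexp F (\<lambda>_. p) (\<lambda>E. \<Sum>x\<in>?I. ?i x E * of_bool (\<not> reachable E d w))"
    unfolding sum_distrib_right[symmetric] sum1 by simp
  also have "\<dots> \<le> rexp F (\<lambda>_. p) (\<lambda>E. \<Sum>x\<in>?I. ?i x E * ?b)"
    unfolding rexp_sum using main by (intro sum_mono)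
  also have "\<dots> = ?b" unfolding sum_distrib_right[symmetric] sum1 using F_fin by simp
  finally show ?thesis .
qed

section \<open>Centred hit indicators and their covariance\<close>

definition "\<mu> = (1/2 :: real) ^ card J"
text \<open>The indicator of a hit minus its approximate conditional mean: on a reachable middle,
  uniform bits on \<open>J\<close> would equal the target with probability
  \<open>\<mu>\<close>.\<close>

definition "\<xi> E d w = (of_bool (hit E d w) - \<mu> * of_bool (reachable E d w) :: real)"

lemma \<mu>: "0 < \<mu>" "\<mu> \<le> 1"
  by (auto simp: \<mu>_def power_le_one)

lemma abs_\<xi>: "\<bar>\<xi> E d w\<bar> \<le> 1"
  using \<mu> by (auto simp: \<xi>_def hit_def)

lemma SA_J: "u \<in> S \<union> A \<Longrightarrow> u \<notin> J"
  using qs(2) J(1) by blast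

text \<open>Resample the edges between \<open>J\<close> and the vertices that are at the bottom for
  \<open>w\<close> and at the top for \<open>w'\<close>. They leave \<open>\<xi> E d w'\<close>
  unchanged, while the average of \<open>\<xi> E d w\<close> over them is small by
  \<open>rexp_parity_vector\<close>.\<close>

lemma rexp_\<xi>_cov:
  "rexp F (\<lambda>_. p) (\<lambda>E. \<xi> E d w * \<xi> E d w')
    \<le> rexp (nsets (S \<union> A) 2) (\<lambda>_. p) (\<lambda>E. \<bar>1 - 2 * p\<bar> ^ card (fst (sw E d w) \<inter> snd (sw E d w')))"
proof -
  let ?l = "\<bar>1 - 2 * p\<bar>"
  let ?h = "\<lambda>E. ?l ^ card (fst (sw E d w) \<inter> snd (sw E d w'))"
  \<comment> \<open>Pairs that avoid \<open>J\<close> already determine both sweeps, and with them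
    \<open>D\<close>.\<close>
  define F1 where "F1 = {e \<in> F. e \<inter> J = {}}"
  define F3 where "F3 = {e \<in> F. e \<inter> J \<noteq> {}}"
  have F: "F = F1 \<union> F3" "F1 \<inter> F3 = {}" "finite F1" "finite F3"
    using F_fin by (auto simp: F1_def F3_def)
  have "rexp F (\<lambda>_. p) (\<lambda>E. \<xi> E d w * \<xi> E d w')
      = rexp F1 (\<lambda>_. p) (\<lambda>E1. rexp F3 (\<lambda>_. p) (\<lambda>E3. \<xi> (E1 \<union> E3) d w * \<xi> (E1 \<union> E3) d w'))"
    unfolding F(1) using F(2-) by (intro rexp_Un)
  also have "\<dots> \<le> rexp F1 (\<lambda>_. p) ?h"
  proof (intro rexp_mono)
    fix E1 assume E1: "E1 \<subseteq> F1"
    obtain P Q where PQ: "sw E1 d w = (P, Q)" by fastforce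
    obtain P' Q' where PQ': "sw E1 d w' = (P', Q')" by fastforce
    note sub = sw_sub[OF PQ] and sub' = sw_sub[OF PQ']
    define D where "D = P \<inter> Q'"
    define G where "G = (\<lambda>(q, h). {q, h}) ` (D \<times> J)"
    define H where "H = F3 - G"
    have D: "D \<subseteq> A" "finite D" "D \<inter> J = {}" "D \<subseteq> P" "D \<inter> P' = {}" "D \<inter> S = {}"
      using sub sub' qs by (auto simp: D_def)
    have "D \<subseteq> V - {r}" "J \<subseteq> V - {r}" using D(1) qs(2) J by blast+
    then have "G \<subseteq> F3" using D(3) by (auto simp: G_def F3_def)
    then have F3: "F3 = H \<union> G" "H \<inter> G = {}" "finite H" "finite G"
      using F(4) finite_subset by (auto simp: H_def)
    have "rexp F3 (\<lambda>_. p) (\<lambda>E3. \<xi> (E1 \<union> E3) d w * \<xi> (E1 \<union> E3) d w')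
       = rexp H (\<lambda>_. p) (\<lambda>E4. rexp G (\<lambda>_. p) (\<lambda>E5. \<xi> (E1 \<union> E4 \<union> E5) d w * \<xi> (E1 \<union> E4 \<union> E5) d w'))"
      unfolding F3(1) Un_assoc using F3(2-) by (intro rexp_Un)
    also have "\<dots> \<le> ?l ^ card D"
    proof (rule rexp_le)
      fix E4 assume E4: "E4 \<subseteq> H"
      define E0 where "E0 = E1 \<union> E4"
      have noJ: "{u, v} \<in> E0 \<longleftrightarrow> {u, v} \<in> E1" if "u \<notin> J" "v \<notin> J" for u v
        using that E4 by (auto simp: E0_def H_def F3_def)
      have noG: "{u, v} \<in> E0 \<union> E5 \<longleftrightarrow> {u, v} \<in> E0" if "E5 \<subseteq> G" "u \<notin> D" "v \<notin> D" for u v E5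
        using that by (auto simp: G_def doubleton_eq_iff)
      have noG': "{u, v} \<in> E0 \<union> E5 \<longleftrightarrow> {u, v} \<in> E0" if "E5 \<subseteq> G" "u \<notin> J" "v \<notin> J" for u v E5
        using that by (auto simp: G_def doubleton_eq_iff)
      have PQ0: "sw E0 d w = (P, Q)"
      proof (rule sweep_cong[OF PQ])
        fix q u assume "q \<in> A" "u \<in> S \<union> P \<union> Q"
        then have "u \<notin> J" "q \<notin> J" using SA_J sub(1,2) by blast+
        then show "{u, q} \<in> E1 \<longleftrightarrow> {u, q} \<in> E0" using noJ by blast
      qed auto
      have PQ0': "sw E0 d w' = (P', Q')"
      proof (rule sweep_cong[OF PQ'])
        fix q u assume "q \<in> A" "u \<in> S \<union> P' \<union> Q'"
        then have "u \<notin> J" "q \<notin> J" using SA_J sub'(1,2) by blast+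
        then show "{u, q} \<in> E1 \<longleftrightarrow> {u, q} \<in> E0" using noJ by blast
      qed auto
      have c: "sw (E0 \<union> E5) d w = (P, Q)" "mid (E0 \<union> E5) d w = mid E0 d w"
        "reachable (E0 \<union> E5) d w \<longleftrightarrow> reachable E0 d w" "target (E0 \<union> E5) d w = target E0 d w"
        if "E5 \<subseteq> G" for E5
      proof -
        have 1: "{u, q} \<in> E0 \<longleftrightarrow> {u, q} \<in> E0 \<union> E5" if "q \<in> A" "u \<in> S \<union> P \<union> Q" for u q
        proof -
          have "u \<notin> J" "q \<notin> J" using SA_J sub(1,2) that by blast+
          then show ?thesis using noG'[OF \<open>E5 \<subseteq> G\<close>] by blast
        qed
        have 2: "e \<in> E0 \<longleftrightarrow> e \<in> E0 \<union> E5" if "e \<in> nsets (V - (S \<union> {r} \<union> P \<union> Q)) 2" for e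
        proof -
          obtain u v where "e = {u, v}" "u \<in> V - (S \<union> {r} \<union> P \<union> Q)" "v \<in> V - (S \<union> {r} \<union> P \<union> Q)"
            using \<open>e \<in> _\<close> by (rule nsets2_E) blast
          moreover from this have "u \<notin> D" "v \<notin> D" by (auto simp: D_def)
          ultimately show ?thesis using noG[OF \<open>E5 \<subseteq> G\<close>] by blast
        qed
        have 3: "{u, v} \<in> E0 \<longleftrightarrow> {u, v} \<in> E0 \<union> E5" if "v \<in> V - (S \<union> {r} \<union> P \<union> Q) - J" "u \<in> S \<union> P" for u v
        proof -
          have "u \<notin> J" "v \<notin> J" using SA_J sub(1,2) that by blast+
          then show ?thesis using noG'[OF \<open>E5 \<subseteq> G\<close>] by blast
        qed
        show "sw (E0 \<union> E5) d w = (P, Q)" "mid (E0 \<union> E5) d w = mid E0 d w"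
          "reachable (E0 \<union> E5) d w \<longleftrightarrow> reachable E0 d w" "target (E0 \<union> E5) d w = target E0 d w"
          using core_cong[OF PQ0 1 2 3] by simp_all
      qed
      \<comment> \<open>For \<open>w'\<close> the set \<open>D\<close> lies at the top, so its edges
        to \<open>J\<close> reach neither the middle nor its bits.\<close>
      have x': "\<xi> (E0 \<union> E5) d w' = \<xi> E0 d w'" if "E5 \<subseteq> G" for E5
      proof -
        have 1: "{u, q} \<in> E0 \<longleftrightarrow> {u, q} \<in> E0 \<union> E5" if "q \<in> A" "u \<in> S \<union> P' \<union> Q'" for u q
        proof -
          have "u \<notin> J" "q \<notin> J" using SA_J sub'(1,2) that by blast+
          then show ?thesis using noG'[OF \<open>E5 \<subseteq> G\<close>] by blast
        qed
        have 2: "e \<in> E0 \<longleftrightarrow> e \<in> E0 \<union> E5" if "e \<in> nsets (V - (S \<union> {r} \<union> P' \<union> Q')) 2" for e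
        proof -
          obtain u v where "e = {u, v}" "u \<in> V - (S \<union> {r} \<union> P' \<union> Q')" "v \<in> V - (S \<union> {r} \<union> P' \<union> Q')"
            using \<open>e \<in> _\<close> by (rule nsets2_E) blast
          moreover from this have "u \<notin> D" "v \<notin> D" by (auto simp: D_def)
          ultimately show ?thesis using noG[OF \<open>E5 \<subseteq> G\<close>] by blast
        qed
        have 3: "{u, v} \<in> E0 \<longleftrightarrow> {u, v} \<in> E0 \<union> E5" if "v \<in> V - (S \<union> {r} \<union> P' \<union> Q')" "u \<in> S \<union> P'" for u v
        proof -
          have "u \<notin> D" "v \<notin> D" using that D(5,6) by (auto simp: D_def)
          then show ?thesis using noG[OF \<open>E5 \<subseteq> G\<close>] by blast
        qed
        note c' = core_cong[OF PQ0' 1 2 3]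
        have "oddnb (E0 \<union> E5) v (S \<union> P') \<longleftrightarrow> oddnb E0 v (S \<union> P')" if "v \<in> mid E0 d w'" for v
          using that sw_sub(6)[OF PQ0'] 3 by (intro oddnb_cong) auto
        then have "bits (E0 \<union> E5) d w' = bits E0 d w'"
          using c' PQ0' by (auto simp: bits_def)
        then show ?thesis using c' by (simp add: \<xi>_def hit_def)
      qed
      have "\<bar>rexp G (\<lambda>_. p) (\<lambda>E5. \<xi> (E0 \<union> E5) d w)\<bar> \<le> ?l ^ card D"
      proof (cases "reachable E0 d w")
        case False
        then have "rexp G (\<lambda>_. p) (\<lambda>E5. \<xi> (E0 \<union> E5) d w) = rexp G (\<lambda>_. p) (\<lambda>_. 0)"
          using c(3) by (intro rexp_cong) (auto simp: \<xi>_def hit_def)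
        then show ?thesis using F3 by simp
      next
        case True
        \<comment> \<open>The target corrected by the parities that \<open>E0\<close> already
          contributes; it is what the edges from \<open>D\<close> still have to produce.\<close>
        define t where "t = sym_diff (target E0 d w) {h \<in> J. oddnb E0 h (S \<union> P)}"
        have tJ: "t \<subseteq> J" using target(1)[OF True] by (auto simp: t_def)
        have "hit (E0 \<union> E5) d w \<longleftrightarrow> {h \<in> J. oddnb E5 h D} = t" if E5: "E5 \<subseteq> G" for E5
        proof -
          have "oddnb (E0 \<union> E5) h (S \<union> P) \<longleftrightarrow> oddnb E0 h (S \<union> P) \<noteq> oddnb E5 h D" if h: "h \<in> J" for h
          proof -
            let ?R = "S \<union> P - D"
            have SP: "S \<union> P = ?R \<union> D" "?R \<inter> D = {}" "finite ?R" using D sub by auto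
            have split: "oddnb E' h (S \<union> P) \<longleftrightarrow> oddnb E' h ?R \<noteq> oddnb E' h D" for E'
              using oddnb_Un[OF SP(3) D(2) SP(2)] SP(1) by simp
            have "oddnb (E0 \<union> E5) h ?R \<longleftrightarrow> oddnb E0 h ?R"
              using noG[OF E5] h D by (intro oddnb_cong) auto
            moreover have notin: "{u, h} \<notin> E0" if "u \<in> D" for u
            proof -
              have "{u, h} \<in> G" using that h by (auto simp: G_def)
              moreover have "{u, h} \<notin> E1" using E1 h by (auto simp: F1_def)
              ultimately show ?thesis using E4 by (auto simp: E0_def H_def)
            qed
            then have "oddnb (E0 \<union> E5) h D \<longleftrightarrow> oddnb E5 h D" by (intro oddnb_cong) auto
            moreover have "oddnb E0 h D \<longleftrightarrow> oddnb {} h D" using notin by (intro oddnb_cong) auto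
            then have "\<not> oddnb E0 h D" by (simp add: oddnb_def)
            ultimately show ?thesis using split by auto
          qed
          moreover have "bits (E0 \<union> E5) d w \<inter> J = {h \<in> J. oddnb (E0 \<union> E5) h (S \<union> P)}"
            using c(1)[OF E5] sw_sub(7)[OF c(1)[OF E5]] by (auto simp: bits_def)
          ultimately have "bits (E0 \<union> E5) d w \<inter> J = sym_diff {h \<in> J. oddnb E0 h (S \<union> P)} {h \<in> J. oddnb E5 h D}"
            by auto
          then have "hit (E0 \<union> E5) d w
            \<longleftrightarrow> sym_diff {h \<in> J. oddnb E0 h (S \<union> P)} {h \<in> J. oddnb E5 h D} = target E0 d w"
            using True c[OF E5] by (simp add: hit_def)
          also have "\<dots> \<longleftrightarrow> {h \<in> J. oddnb E5 h D} = t" unfolding t_def by blast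
          finally show ?thesis .
        qed
        then have "rexp G (\<lambda>_. p) (\<lambda>E5. \<xi> (E0 \<union> E5) d w)
           = rexp G (\<lambda>_. p) (\<lambda>E5. of_bool ({h \<in> J. oddnb E5 h D} = t) - \<mu>)"
          using c True by (intro rexp_cong) (auto simp: \<xi>_def)
        also have "\<dots> = rexp G (\<lambda>_. p) (\<lambda>E5. of_bool ({h \<in> J. oddnb E5 h D} = t)) - \<mu>"
          using F3 by (simp add: rexp_diff)
        finally show ?thesis
          using rexp_parity_vector[OF D(2) J_fin D(3) tJ p01] by (simp add: G_def \<mu>_def)
      qed
      then have "\<bar>rexp G (\<lambda>_. p) (\<lambda>E5. \<xi> (E0 \<union> E5) d w)\<bar> * \<bar>\<xi> E0 d w'\<bar> \<le> ?l ^ card D * 1"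
        using abs_\<xi> by (intro mult_mono) auto
      moreover have "rexp G (\<lambda>_. p) (\<lambda>E5. \<xi> (E0 \<union> E5) d w * \<xi> (E0 \<union> E5) d w')
          = rexp G (\<lambda>_. p) (\<lambda>E5. \<xi> (E0 \<union> E5) d w) * \<xi> E0 d w'"
        unfolding rexp_multc[symmetric] using x' by (intro rexp_cong) auto
      ultimately show "rexp G (\<lambda>_. p) (\<lambda>E5. \<xi> (E1 \<union> E4 \<union> E5) d w * \<xi> (E1 \<union> E4 \<union> E5) d w') \<le> ?l ^ card D"
        unfolding E0_def[symmetric] by (simp add: abs_mult[symmetric])
    qed (use F3 p01 in auto)
    finally show "rexp F3 (\<lambda>_. p) (\<lambda>E3. \<xi> (E1 \<union> E3) d w * \<xi> (E1 \<union> E3) d w') \<le> ?h E1"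
      by (simp add: PQ PQ' D_def)
  qed (use p01 in auto)
  \<comment> \<open>The exponent depends on the sweeps alone, which see only pairs inside
    \<open>S \<union> A\<close>.\<close>
  also have "rexp F1 (\<lambda>_. p) ?h = rexp F1 (\<lambda>_. p) (\<lambda>E. ?h (E \<inter> nsets (S \<union> A) 2))"
  proof (intro rexp_cong refl)
    fix E
    have "sw (E \<inter> nsets (S \<union> A) 2) d w = sw E d w" if "E \<subseteq> F1" for w
    proof -
      obtain P Q where PQ: "sw E d w = (P, Q)" by fastforce
      have noloop: "{q} \<notin> E" for q using that by (auto simp: F1_def nsets_def)
      show ?thesis unfolding PQ
      proof (rule sweep_cong[OF PQ])
        fix q u assume q: "q \<in> A" "u \<in> S \<union> P \<union> Q"
        then have "u \<in> S \<union> A" using sw_sub(1,2)[OF PQ] by auto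
        then show "{u, q} \<in> E \<longleftrightarrow> {u, q} \<in> E \<inter> nsets (S \<union> A) 2" using q noloop[of q] by auto
      qed auto
    qed
    then show "E \<subseteq> F1 \<Longrightarrow> ?h E = ?h (E \<inter> nsets (S \<union> A) 2)" by simp
  qed
  also have "\<dots> = rexp (nsets (S \<union> A) 2) (\<lambda>_. p) ?h"
  proof (rule rexp_restrict)
    have "(S \<union> A) \<inter> J = {}" "S \<union> A \<subseteq> V - {r}" using qs J ends by auto
    then show "nsets (S \<union> A) 2 \<subseteq> F1" unfolding F1_def nsets_def by blast
  qed (use F in auto)
  finally show ?thesis .
qed

text \<open>The first term bounds the second moment divided by \<open>\<mu>\<^sup>2\<close>, up to
  the factor 4; the second one accounts for choices that are not reachable.\<close>

definition "fail_bound \<kappa> = 4 * 4 ^ card J * (1 - \<delta> ^ 8 * (1 - \<bar>1 - 2 * p\<bar>) / 8) ^ length qs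
  + 2 * (\<kappa> ^ (card J - 1) * exp (1 / (1 - \<kappa>)\<^sup>2))"

text \<open>For fixed \<open>E\<close> and \<open>d\<close>, let \<open>u\<close> be the proportion
  of unreachable choices \<open>w\<close>. Without any hit the average of \<open>\<xi>\<close> over
  \<open>w\<close> is \<open>\<mu> * (u - 1)\<close>. Its square is an average over independent
  pairs \<open>w\<close>, \<open>w'\<close>, to which the covariance bound and
  \<open>sweep_pair\<close> apply.\<close>

lemma rexp_no_hit:
  assumes k: "0 < \<kappa>" "\<kappa> < 1" and pk: "1 - \<kappa>\<^sup>2 \<le> p" "p \<le> \<kappa>\<^sup>2"
  shows "rexp A (\<lambda>_. 1/2) (\<lambda>d. rexp F (\<lambda>_. p) (\<lambda>E. of_bool (\<not> (\<exists>w. hit E d w)))) \<le> fail_bound \<kappa>"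
proof -
  let ?W = "rexp A (\<lambda>_. 1/2)"
  let ?b = "\<kappa> ^ (card J - 1) * exp (1 / (1 - \<kappa>)\<^sup>2)"
  have fin: "finite A" by simp
  have pt: "of_bool (\<not> (\<exists>w. hit E d w))
      \<le> 4 * 4 ^ card J * ?W (\<lambda>w. ?W (\<lambda>w'. \<xi> E d w * \<xi> E d w')) + 2 * ?W (\<lambda>w. of_bool (\<not> reachable E d w))"
    for E d
  proof -
    let ?u = "?W (\<lambda>w. of_bool (\<not> reachable E d w))"
    have sq: "?W (\<lambda>w. ?W (\<lambda>w'. \<xi> E d w * \<xi> E d w')) = (?W (\<lambda>w. \<xi> E d w))\<^sup>2"
      by (simp only: rexp_cmult rexp_multc power2_eq_square)
    have u: "0 \<le> ?u" by (intro rexp_nonneg) auto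
    show ?thesis
    proof (cases "\<exists>w. hit E d w")
      case True
      then show ?thesis unfolding sq using u by simp
    next
      case False
      then have "?W (\<lambda>w. \<xi> E d w) = ?W (\<lambda>w. \<mu> * of_bool (\<not> reachable E d w) - \<mu>)"
        by (intro rexp_cong) (auto simp: \<xi>_def)
      also have "\<dots> = \<mu> * (?u - 1)"
        by (simp only: rexp_diff rexp_cmult rexp_const[OF fin]) (simp add: algebra_simps)
      finally have "4 * 4 ^ card J * (?W (\<lambda>w. \<xi> E d w))\<^sup>2 = 4 * (?u - 1)\<^sup>2 * (4 ^ card J * \<mu>\<^sup>2)"
        by (simp add: power_mult_distrib)
      also have "4 ^ card J * \<mu>\<^sup>2 = 1"
      proof -
        have "(4::real) ^ n * ((1/2) ^ n)\<^sup>2 = 1" for n :: nat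
          by (induction n) (simp_all add: power2_eq_square field_simps)
        then show ?thesis by (simp only: \<mu>_def)
      qed
      finally have "4 * 4 ^ card J * (?W (\<lambda>w. \<xi> E d w))\<^sup>2 = 4 * (?u - 1)\<^sup>2" by simp
      \<comment> \<open>Either many choices are unreachable or the average of \<open>\<xi>\<close>
        is far from 0; completing the square covers both cases at once.\<close>
      moreover have "1 \<le> 4 * (?u - 1)\<^sup>2 + 2 * ?u"
      proof -
        have "4 * (?u - 1)\<^sup>2 + 2 * ?u - 1 = (2 * ?u - 3/2)\<^sup>2 + 3/4"
          by (simp add: power2_eq_square algebra_simps)
        then show ?thesis using zero_le_power2[of "2 * ?u - 3/2"] by linarith
      qed
      ultimately show ?thesis unfolding sq using False by simp
    qed
  qed
  have "?W (\<lambda>d. rexp F (\<lambda>_. p) (\<lambda>E. of_bool (\<not> (\<exists>w. hit E d w))))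
    \<le> ?W (\<lambda>d. rexp F (\<lambda>_. p) (\<lambda>E. 4 * 4 ^ card J * ?W (\<lambda>w. ?W (\<lambda>w'. \<xi> E d w * \<xi> E d w'))
        + 2 * ?W (\<lambda>w. of_bool (\<not> reachable E d w))))"
    using p01 pt by (intro rexp_mono) auto
  also have "\<dots> = 4 * 4 ^ card J * ?W (\<lambda>d. rexp F (\<lambda>_. p) (\<lambda>E. ?W (\<lambda>w. ?W (\<lambda>w'. \<xi> E d w * \<xi> E d w'))))
      + 2 * ?W (\<lambda>d. rexp F (\<lambda>_. p) (\<lambda>E. ?W (\<lambda>w. of_bool (\<not> reachable E d w))))"
    by (simp only: rexp_add rexp_cmult)
  also have "?W (\<lambda>d. rexp F (\<lambda>_. p) (\<lambda>E. ?W (\<lambda>w. of_bool (\<not> reachable E d w)))) \<le> ?b"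
    unfolding rexp_swap[of F] by (intro rexp_le[of A] rexp_not_reachable[OF k pk]) auto
  also have "?W (\<lambda>d. rexp F (\<lambda>_. p) (\<lambda>E. ?W (\<lambda>w. ?W (\<lambda>w'. \<xi> E d w * \<xi> E d w'))))
     = ?W (\<lambda>d. ?W (\<lambda>w. ?W (\<lambda>w'. rexp F (\<lambda>_. p) (\<lambda>E. \<xi> E d w * \<xi> E d w'))))"
    unfolding rexp_swap[of F] ..
  also have "\<dots> \<le> ?W (\<lambda>d. ?W (\<lambda>w. ?W (\<lambda>w'. rexp (nsets (S \<union> A) 2) (\<lambda>_. p)
      (\<lambda>E. \<bar>1 - 2 * p\<bar> ^ card (fst (sw E d w) \<inter> snd (sw E d w'))))))"
    by (intro rexp_mono rexp_\<xi>_cov) auto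
  also have "\<dots> \<le> (1 - \<delta> ^ 8 * (1 - \<bar>1 - 2 * p\<bar>) / 8) ^ length qs"
    using p01 qs \<delta> by (intro sweep_pair) auto
  finally show ?thesis by (simp add: fail_bound_def)
qed

text \<open>The degree parity of a vertex in \<open>qs\<close> is its pad plus its parity in the
  rest of the graph. By \<open>rexp_flip\<close> the set of odd degrees is therefore uniform and
  independent of \<open>E\<close>, so \<open>d\<close> may be averaged separately.\<close>

lemma rexp_not_grow:
  assumes k: "0 < \<kappa>" "\<kappa> < 1" and pk: "1 - \<kappa>\<^sup>2 \<le> p" "p \<le> \<kappa>\<^sup>2"
    and s: "\<And>x. 0 \<le> s x \<and> s x \<le> 1" "\<And>q. q \<in> A \<Longrightarrow> s q = 1/2"
  shows "rexp (V - {r}) s (\<lambda>R. rexp F (\<lambda>_. p) (\<lambda>E. of_bool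
      ((even (card (E \<union> (\<lambda>u. {u, r}) ` R)) \<longleftrightarrow> {a, b} \<notin> E \<union> (\<lambda>u. {u, r}) ` R)
        \<and> \<not> grow (E \<union> (\<lambda>u. {u, r}) ` R) {} {} {a, b} V))) \<le> fail_bound \<kappa>"
proof -
  let ?st = "\<lambda>u. {u, r}"
  let ?bad = "\<lambda>E. (even (card E) \<longleftrightarrow> {a, b} \<notin> E) \<and> \<not> grow E {} {} {a, b} V"
  let ?f = "\<lambda>R E. of_bool (?bad (E \<union> ?st ` R)) :: real"
  let ?Z = "V - {r} - A"
  have Z: "V - {r} = ?Z \<union> A" "?Z \<inter> A = {}" "finite ?Z" using qs finV by auto
  have "rexp (V - {r}) s (\<lambda>R. rexp F (\<lambda>_. p) (?f R))
     = rexp (?Z \<union> A) s (\<lambda>R. rexp F (\<lambda>_. p) (?f R))" using Z(1) by simp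
  also have "\<dots> = rexp ?Z s (\<lambda>R1. rexp A s (\<lambda>R2. rexp F (\<lambda>_. p) (?f (R1 \<union> R2))))"
    using Z by (intro rexp_Un) auto
  also have "\<dots> = rexp ?Z s (\<lambda>R1. rexp A (\<lambda>_. 1/2) (\<lambda>R2. rexp F (\<lambda>_. p) (?f (R1 \<union> R2))))"
  proof -
    have "rexp A s g = rexp A (\<lambda>_. 1/2) g" for g using s(2) by (intro rexp_cong) auto
    then show ?thesis by simp
  qed
  also have "\<dots> \<le> fail_bound \<kappa>"
  proof (rule rexp_le)
    fix R1 assume R1: "R1 \<subseteq> ?Z"
    \<comment> \<open>The parities masked by the pads; they depend on \<open>E\<close> but not on
      \<open>R2\<close>.\<close>
    let ?C = "\<lambda>E. {q \<in> A. oddnb E q (V - {r})}"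
    have "rexp A (\<lambda>_. 1/2) (\<lambda>R2. rexp F (\<lambda>_. p) (?f (R1 \<union> R2)))
       = rexp F (\<lambda>_. p) (\<lambda>E. rexp A (\<lambda>_. 1/2) (\<lambda>R2. ?f (R1 \<union> R2) E))" by (rule rexp_swap)
    also have "\<dots> \<le> rexp F (\<lambda>_. p) (\<lambda>E. rexp A (\<lambda>_. 1/2) (\<lambda>R2. of_bool (\<not> (\<exists>w. hit E (sym_diff R2 (?C E)) w))))"
    proof (intro rexp_mono)
      fix E R2 assume E: "E \<subseteq> F" and R2: "R2 \<subseteq> A"
      let ?E = "E \<union> ?st ` (R1 \<union> R2)"
      have deg: "q \<in> sym_diff R2 (?C E) \<longleftrightarrow> oddnb ?E q V" if q: "q \<in> A" for q
      proof -
        have "V = insert r (V - {r})" using ends by auto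
        then have "oddnb ?E q V \<longleftrightarrow> oddnb ?E q (V - {r}) \<noteq> ({r, q} \<in> ?E)"
          using oddnb_insert[of "V - {r}" r ?E q] finV by auto
        moreover have "{r, q} \<in> ?E \<longleftrightarrow> q \<in> R2"
          using E q R1 qs by (auto simp: doubleton_eq_iff nsets_def)
        moreover have "oddnb ?E q (V - {r}) \<longleftrightarrow> oddnb E q (V - {r})"
          using q qs by (intro oddnb_cong) (auto simp: doubleton_eq_iff)
        ultimately show ?thesis using q R2 by auto
      qed
      have "\<not> ?bad ?E" if "hit E (sym_diff R2 (?C E)) w" for w
      proof -
        have "R1 \<union> R2 \<subseteq> V - {r}" using R1 R2 Z(1) by blast
        from hit_imp_grow[OF E this refl deg _ that] show ?thesis by blast
      qed
      then show "?f (R1 \<union> R2) E \<le> of_bool (\<not> (\<exists>w. hit E (sym_diff R2 (?C E)) w))" by auto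
    qed (use p01 in auto)
    also have "\<dots> = rexp F (\<lambda>_. p) (\<lambda>E. rexp A (\<lambda>_. 1/2) (\<lambda>d. of_bool (\<not> (\<exists>w. hit E d w))))"
    proof -
      have "rexp A (\<lambda>_. 1/2) (\<lambda>R2. of_bool (\<not> (\<exists>w. hit E (sym_diff R2 (?C E)) w)) :: real)
        = rexp A (\<lambda>_. 1/2) (\<lambda>d. of_bool (\<not> (\<exists>w. hit E d w)))" for E
        by (rule rexp_flip[of A "?C E" "\<lambda>d. of_bool (\<not> (\<exists>w. hit E d w))"]) auto
      then show ?thesis by (simp only:)
    qed
    also have "\<dots> = rexp A (\<lambda>_. 1/2) (\<lambda>d. rexp F (\<lambda>_. p) (\<lambda>E. of_bool (\<not> (\<exists>w. hit E d w))))"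
      by (rule rexp_swap)
    also have "\<dots> \<le> fail_bound \<kappa>" using k pk by (rule rexp_no_hit)
    finally show "rexp A (\<lambda>_. 1/2) (\<lambda>R2. rexp F (\<lambda>_. p) (?f (R1 \<union> R2))) \<le> fail_bound \<kappa>" .
  qed (use Z s in auto)
  finally show ?thesis .
qed

end

section \<open>Assembling the bound\<close>

text \<open>The mixture makes the pads of a random set of vertices uniform, each with probability
  \<open>2 * \<delta>\<close>, and freezes the other pads in \<open>W\<close>. The uniform ones form
  the list \<open>qs\<close>, and \<open>rexp_geom\<close> averages the bound over their
  number.\<close>

lemma rexp_not_grow_uniform:
  fixes V :: "'a set" and p \<delta> \<kappa> \<rho> :: real
  assumes V: "finite V" "a \<in> V" "b \<in> V" "r \<in> V" "a \<noteq> b" "a \<noteq> r" "b \<noteq> r"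
    and J: "J \<subseteq> V - {a, b, r}" "J \<noteq> {}"
    and p: "0 < p" "p < 1" and \<delta>: "\<delta> = min p (1 - p)" and k: "\<kappa> = sqrt (1 - \<delta>)"
    and \<rho>: "\<rho> = 1 - \<delta> ^ 8 * (1 - \<bar>1 - 2 * p\<bar>) / 8"
  shows "rexp (nsets V 2) (\<lambda>_. p) (\<lambda>E. of_bool
      ((even (card E) \<longleftrightarrow> {a, b} \<notin> E) \<and> \<not> grow E {} {} {a, b} V))
    \<le> 4 * 4 ^ card J * (1 - 2 * \<delta> * (1 - \<rho>)) ^ card (V - {a, b, r} - J)
      + 2 * (\<kappa> ^ (card J - 1) * exp (1 / (1 - \<kappa>)\<^sup>2))"
proof -
  let ?bad = "\<lambda>E. of_bool ((even (card E) \<longleftrightarrow> {a, b} \<notin> E) \<and> \<not> grow E {} {} {a, b} V) :: real"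
  let ?F = "nsets (V - {r}) 2" and ?st = "\<lambda>u. {u, r}"
  let ?B = "2 * (\<kappa> ^ (card J - 1) * exp (1 / (1 - \<kappa>)\<^sup>2))"
  define W where "W = V - {a, b, r} - J"
  define Z where "Z = V - {r} - W"
  define h where "h R = rexp ?F (\<lambda>_. p) (\<lambda>E. ?bad (E \<union> ?st ` R))" for R
  define c :: real where "c = (if p \<le> 1/2 then 0 else 1)"
  define s where "s A e = (if e \<in> W then if e \<in> A then 1/2 else c else p)" for A e
  have \<delta>': "0 < \<delta>" "\<delta> \<le> p" "p \<le> 1 - \<delta>" "\<delta> \<le> 1/2" using \<delta> p by (auto simp: min_def)
  have k': "0 < \<kappa>" "\<kappa> < 1" "\<kappa>\<^sup>2 = 1 - \<delta>" using k \<delta>' by auto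
  have mix: "p = 2 * \<delta> * (1/2) + (1 - 2 * \<delta>) * c" using \<delta> by (auto simp: c_def min_def)
  have W: "V - {r} = Z \<union> W" "Z \<inter> W = {}" "finite Z" "finite W" using V by (auto simp: Z_def W_def)
  have fin: "finite ?F" using V by (simp add: finite_imp_finite_nsets)
  have star: "nsets V 2 = ?F \<union> ?st ` (V - {r})" "?F \<inter> ?st ` (V - {r}) = {}"
    using nsets2_insert[of r "V - {r}"] star_disjoint[of r "V - {r}" "V - {r}"] V
    by (simp_all add: insert_absorb Un_commute Int_commute)
  have "rexp (nsets V 2) (\<lambda>_. p) ?bad
      = rexp ?F (\<lambda>_. p) (\<lambda>E. rexp (V - {r}) (\<lambda>_. p) (\<lambda>R. ?bad (E \<union> ?st ` R)))"
    unfolding star(1) using V fin star(2)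
    by (subst rexp_Un) (auto simp: rexp_image[OF _ inj_on_star])
  also have "\<dots> = rexp (Z \<union> W) (\<lambda>_. p) h"
    unfolding h_def W(1)[symmetric] by (rule rexp_swap)
  also have "\<dots> = rexp Z (\<lambda>_. p) (\<lambda>R1. rexp W (\<lambda>_. p) (\<lambda>R2. h (R1 \<union> R2)))"
    using W by (intro rexp_Un)
  also have "\<dots> = rexp Z (\<lambda>_. p) (\<lambda>R1. rexp W (\<lambda>_. 2 * \<delta>) (\<lambda>A.
      rexp W (\<lambda>e. if e \<in> A then 1/2 else c) (\<lambda>R2. h (R1 \<union> R2))))"
    using rexp_mixture[OF W(4), of "\<lambda>_. p" "2 * \<delta>" "1/2" c, OF mix] by simp
  also have "\<dots> = rexp W (\<lambda>_. 2 * \<delta>) (\<lambda>A. rexp Z (\<lambda>_. p) (\<lambda>R1.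
      rexp W (\<lambda>e. if e \<in> A then 1/2 else c) (\<lambda>R2. h (R1 \<union> R2))))"
    by (rule rexp_swap)
  also have "\<dots> = rexp W (\<lambda>_. 2 * \<delta>) (\<lambda>A. rexp (V - {r}) (s A) h)"
  proof -
    have "rexp Z (\<lambda>_. p) g = rexp Z (s A) g" for A g
      using W(2) by (intro rexp_cong) (auto simp: s_def)
    moreover have "rexp W (\<lambda>e. if e \<in> A then 1/2 else c) g = rexp W (s A) g" for A g
      by (intro rexp_cong) (auto simp: s_def)
    ultimately show ?thesis unfolding W(1) using rexp_Un[OF W(3,4,2)] by simp
  qed
  also have "\<dots> \<le> rexp W (\<lambda>_. 2 * \<delta>) (\<lambda>A. 4 * 4 ^ card J * \<rho> ^ card A + ?B)"
  proof (rule rexp_mono)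
    fix U assume U: "U \<subseteq> W"
    then have "finite U" using W finite_subset by blast
    then obtain us where us: "set us = U" "distinct us" using finite_distinct_list by blast
    have "U \<subseteq> V - {a, b, r} - J" using U by (simp add: W_def)
    then interpret parity_setup V a b r us J p \<delta>
      using V J \<delta>' us by unfold_locales simp_all
    have s: "0 \<le> s U e \<and> s U e \<le> 1" for e using p by (auto simp: s_def c_def)
    have s': "s U q = 1/2" if "q \<in> set us" for q using that U us by (auto simp: s_def)
    have "rexp (V - {r}) (s U) h \<le> fail_bound \<kappa>"
      unfolding h_def using k' \<delta>' by (intro rexp_not_grow s s') auto
    also have "\<dots> = 4 * 4 ^ card J * \<rho> ^ card U + ?B"
      unfolding fail_bound_def \<rho> using us distinct_card[of us] by simp
    finally show "rexp (V - {r}) (s U) h \<le> 4 * 4 ^ card J * \<rho> ^ card U + ?B" .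
  qed (use \<delta>' in auto)
  also have "\<dots> = 4 * 4 ^ card J * (1 - 2 * \<delta> * (1 - \<rho>)) ^ card W + ?B"
    using W by (simp only: rexp_add rexp_cmult rexp_geom rexp_const)
  finally show ?thesis by (simp add: W_def)
qed

text \<open>One end is the vertex 0. Unless it is isolated or adjacent to all others, some
  \<open>i\<close> makes \<open>{0, i}\<close> an edge exactly when the number of edges is odd; a
  union bound over \<open>i\<close> then suffices.\<close>

lemma prob_not_even_degenerate_le:
  fixes p \<delta> \<kappa> \<rho> :: real
  assumes p: "0 < p" "p < 1" and \<delta>: "\<delta> = min p (1 - p)" and k: "\<kappa> = sqrt (1 - \<delta>)"
    and \<rho>: "\<rho> = 1 - \<delta> ^ 8 * (1 - \<bar>1 - 2 * p\<bar>) / 8" and j: "1 \<le> j" "j + 3 \<le> n"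
  shows "measure_pmf.prob (erdos_renyi n p) {E. \<not> even_degenerate {..<n} E}
    \<le> 2 * (1 - \<delta>) ^ (n - 1) + n * (4 * 4 ^ j * (1 - 2 * \<delta> * (1 - \<rho>)) ^ (n - 3 - j)
      + 2 * (\<kappa> ^ (j - 1) * exp (1 / (1 - \<kappa>)\<^sup>2)))" (is "_ \<le> _ + _ * ?b")
proof -
  let ?V = "{..<n}" and ?I = "{1..<n}" and ?st = "\<lambda>u. {u, 0 :: nat}"
  let ?F = "nsets ?V 2" and ?S = "?st ` ?I"
  let ?bad = "\<lambda>i E. of_bool ((even (card E) \<longleftrightarrow> {0, i} \<notin> E) \<and> \<not> grow E {} {} {0, i} ?V) :: real"
  have fin: "finite ?F" by (simp add: finite_imp_finite_nsets)
  have p01: "0 \<le> p" "p \<le> 1" using p by auto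
  have SF: "?S \<subseteq> ?F" by auto
  have "card ?S = n - 1" using card_image[OF inj_on_star[of 0 ?I]] by simp
  then have all: "rexp ?F (\<lambda>_. p) (\<lambda>E. of_bool (E \<inter> ?S = A)) \<le> (1 - \<delta>) ^ (n - 1)" for A
    using rexp_restrict[OF fin SF, of "\<lambda>_. p" "\<lambda>E. of_bool (E = A)"] rexp_single[of ?S p "1 - \<delta>" A] p \<delta>
    by (simp add: min_def split: if_splits)
  have bad: "rexp ?F (\<lambda>_. p) (?bad i) \<le> ?b" if i: "i \<in> ?I" for i
  proof -
    have "card (?V - {0, i}) = n - 2" using i by (simp add: card_Diff_subset)
    then have "0 < card (?V - {0, i})" using j by linarith
    then have "?V - {0, i} \<noteq> {}" by (auto simp: card_gt_0_iff)
    then obtain r where r: "r \<in> ?V" "r \<noteq> 0" "r \<noteq> i" by blast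
    have c: "card (?V - {0, i, r}) = n - 3" using i r by (subst card_Diff_subset) auto
    then obtain J where J: "J \<subseteq> ?V - {0, i, r}" "card J = j" "finite J"
      using obtain_subset_with_card_n[of j "?V - {0, i, r}"] j by (metis add_le_imp_le_diff)
    have W: "card (?V - {0, i, r} - J) = n - 3 - j" using J c by (simp add: card_Diff_subset)
    have "J \<noteq> {}" using J j by auto
    with i r J(1) have "rexp ?F (\<lambda>_. p) (?bad i)
      \<le> 4 * 4 ^ card J * (1 - 2 * \<delta> * (1 - \<rho>)) ^ card (?V - {0, i, r} - J)
        + 2 * (\<kappa> ^ (card J - 1) * exp (1 / (1 - \<kappa>)\<^sup>2))"
      by (intro rexp_not_grow_uniform p \<delta> k \<rho>) auto
    then show ?thesis unfolding W J(2) .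
  qed
  have "measure_pmf.prob (erdos_renyi n p) {E. \<not> even_degenerate ?V E}
      = rexp ?F (\<lambda>_. p) (\<lambda>E. of_bool (\<not> even_degenerate ?V E))"
    unfolding erdos_renyi_def using fin p by (subst prob_random_subset) auto
  also have "\<dots> \<le> rexp ?F (\<lambda>_. p) (\<lambda>E. of_bool (E \<inter> ?S = {}) + of_bool (E \<inter> ?S = ?S) + (\<Sum>i\<in>?I. ?bad i E))"
  proof (rule rexp_mono)
    fix E
    have nn: "0 \<le> (\<Sum>i\<in>?I. ?bad i E)" by (intro sum_nonneg) auto
    show "of_bool (\<not> even_degenerate ?V E)
      \<le> of_bool (E \<inter> ?S = {}) + of_bool (E \<inter> ?S = ?S) + (\<Sum>i\<in>?I. ?bad i E)"
    proof (cases "even_degenerate ?V E \<or> E \<inter> ?S = {} \<or> E \<inter> ?S = ?S")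
      case True
      then show ?thesis using nn by (auto simp: of_bool_def)
    next
      case False
      \<comment> \<open>Both a neighbour and a non-neighbour of 0 are at hand; the parity of
        \<open>card E\<close> decides which one is used.\<close>
      then obtain i i' where "i \<in> ?I" "{i, 0} \<in> E" "i' \<in> ?I" "{i', 0} \<notin> E" by blast
      then obtain l where l: "l \<in> ?I" "even (card E) \<longleftrightarrow> {0, l} \<notin> E"
        by (cases "even (card E)") (auto simp: insert_commute)
      then have "\<not> grow E {} {} {0, l} ?V" using False even_degenerate_grow[of E 0 l ?V] by auto
      then have "1 = ?bad l E" using l by simp
      also have "\<dots> \<le> (\<Sum>i\<in>?I. ?bad i E)" using l(1) by (intro member_le_sum) auto
      finally show ?thesis using nn by (auto simp: of_bool_def)
    qed
  qed (use p in auto)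
  also have "\<dots> \<le> (1 - \<delta>) ^ (n - 1) + (1 - \<delta>) ^ (n - 1) + (\<Sum>i\<in>?I. ?b)"
    unfolding rexp_add rexp_sum by (intro add_mono all sum_mono bad)
  also have "(\<Sum>i\<in>?I. ?b) \<le> n * ?b"
  proof -
    have "0 \<le> ?b" using bad[of 1] rexp_nonneg[of ?F "\<lambda>_. p" "?bad 1"] p01 j by force
    then show ?thesis by (simp add: mult_right_mono)
  qed
  finally show ?thesis by simp
qed

section \<open>Asymptotics\<close>

text \<open>After multiplication by \<open>exp (c / 2 * sqrt x)\<close> each summand tends to 0.
  Giving up half of \<open>c\<close> absorbs the factor \<open>x\<close> of the union bound; the
  terms with \<open>t\<close> and \<open>s\<close> decay linearly in the exponent.\<close>

lemma eventually_bound: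
  fixes t s c D :: real
  assumes "0 < t" "0 < s" "0 < c"
  shows "\<forall>\<^sub>F x in at_top. 2 * exp (- t * (x - 1)) + x * (4 * exp (ln 4 * sqrt x - s * (x - 3 - sqrt x))
    + 2 * (exp (- c * (sqrt x - 2)) * D)) \<le> exp (- (c / 2) * sqrt x)"
proof -
  let ?f = "\<lambda>x. 2 * exp (c / 2 * sqrt x - t * (x - 1))
    + 4 * (x * exp ((c / 2 + ln 4 + s) * sqrt x - s * (x - 3)))
    + 2 * D * (x * exp (- (c / 2) * sqrt x + 2 * c))"
  have "((\<lambda>x. 2 * exp (c / 2 * sqrt x - t * (x - 1))) \<longlongrightarrow> 0) at_top"
    using assms by real_asymp
  moreover have "((\<lambda>x. x * exp ((c / 2 + ln 4 + s) * sqrt x - s * (x - 3))) \<longlongrightarrow> 0) at_top"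
    using assms by real_asymp
  moreover have "((\<lambda>x. x * exp (- (c / 2) * sqrt x + 2 * c)) \<longlongrightarrow> 0) at_top"
    using assms by real_asymp
  ultimately have "(?f \<longlongrightarrow> 0 + 4 * 0 + 2 * D * 0) at_top" by (intro tendsto_intros)
  then have "\<forall>\<^sub>F x in at_top. ?f x < 1" by (rule order_tendstoD) simp
  then show ?thesis
  proof eventually_elim
    case (elim x)
    have "exp (- (c / 2) * sqrt x) * ?f x = 2 * exp (- t * (x - 1))
      + x * (4 * exp (ln 4 * sqrt x - s * (x - 3 - sqrt x)) + 2 * (exp (- c * (sqrt x - 2)) * D))"
    proof -
      have 1: "exp (- (c / 2) * sqrt x) * exp (c / 2 * sqrt x - t * (x - 1)) = exp (- t * (x - 1))"
        by (simp add: exp_add[symmetric])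
      have 2: "exp (- (c / 2) * sqrt x) * exp ((c / 2 + ln 4 + s) * sqrt x - s * (x - 3))
        = exp (ln 4 * sqrt x - s * (x - 3 - sqrt x))"
        unfolding exp_add[symmetric] by (rule arg_cong[where f = exp]) (simp add: algebra_simps)
      have 3: "exp (- (c / 2) * sqrt x) * exp (- (c / 2) * sqrt x + 2 * c) = exp (- c * (sqrt x - 2))"
        unfolding exp_add[symmetric] by (rule arg_cong[where f = exp]) (simp add: algebra_simps)
      show ?thesis unfolding 1[symmetric] 2[symmetric] 3[symmetric] by (simp only: ring_distribs mult_ac)
    qed
    moreover have "exp (- (c / 2) * sqrt x) * ?f x \<le> exp (- (c / 2) * sqrt x) * 1"
      using elim by (intro mult_left_mono) auto
    ultimately show ?case by simp
  qed
qed

theorem theorem1p3: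
  fixes p \<alpha> :: real
  assumes "0 < p" and "p < 1" and "\<alpha> > 0"
  shows "\<exists>c>0. \<exists>n0::nat. \<forall>n\<ge>n0.
    measure_pmf.prob (erdos_renyi n p) {E. \<not> even_degenerate {..<n} E}
      \<le> exp (- c * real n powr (1/2 - \<alpha>))"
proof -
  define \<delta> where "\<delta> = min p (1 - p)"
  define \<kappa> where "\<kappa> = sqrt (1 - \<delta>)"
  define \<rho> where "\<rho> = 1 - \<delta> ^ 8 * (1 - \<bar>1 - 2 * p\<bar>) / 8"
  define \<sigma> where "\<sigma> = 1 - 2 * \<delta> * (1 - \<rho>)"
  define D where "D = exp (1 / (1 - \<kappa>)\<^sup>2)"
  have \<delta>: "0 < \<delta>" "\<delta> \<le> 1/2" using assms by (auto simp: \<delta>_def min_def)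
  have \<kappa>: "0 < \<kappa>" "\<kappa> < 1" using \<delta> by (auto simp: \<kappa>_def)
  have "0 < 1 - \<bar>1 - 2 * p\<bar>" "1 - \<bar>1 - 2 * p\<bar> \<le> 1" using assms by auto
  moreover have "0 < \<delta> ^ 8" "\<delta> ^ 8 \<le> 1" using \<delta> by (auto intro: power_le_one)
  ultimately have "0 < 1 - \<rho>" "1 - \<rho> \<le> 1 / 8"
    using mult_mono[of "\<delta> ^ 8" 1 "1 - \<bar>1 - 2 * p\<bar>" 1] by (auto simp: \<rho>_def)
  then have "0 < 2 * \<delta> * (1 - \<rho>)" "2 * \<delta> * (1 - \<rho>) \<le> 1 * (1 / 8)"
    using \<delta> by (simp, intro mult_mono) auto
  then have \<sigma>: "0 < \<sigma>" "\<sigma> < 1" by (auto simp: \<sigma>_def)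
  define t s c where "t = - ln (1 - \<delta>)" and "s = - ln \<sigma>" and "c = - ln \<kappa>"
  have pos: "0 < t" "0 < s" "0 < c" using \<delta> \<sigma> \<kappa> by (auto simp: t_def s_def c_def)
  have pow: "z ^ m = exp (real m * ln z)" if "0 < z" for z :: real and m
    using that by (simp add: exp_of_nat_mult)
  have "\<forall>\<^sub>F n in sequentially. 2 * exp (- t * (real n - 1)) + real n * (4 * exp (ln 4 * sqrt n - s * (real n - 3 - sqrt n))
    + 2 * (exp (- c * (sqrt n - 2)) * D)) \<le> exp (- (c / 2) * sqrt n)"
    using eventually_compose_filterlim[OF eventually_bound[OF pos, of D] filterlim_real_sequentially] .
  then obtain n1 where n1: "\<And>n. n \<ge> n1 \<Longrightarrow> 2 * exp (- t * (real n - 1))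
    + real n * (4 * exp (ln 4 * sqrt n - s * (real n - 3 - sqrt n)) + 2 * (exp (- c * (sqrt n - 2)) * D))
    \<le> exp (- (c / 2) * sqrt n)"
    unfolding eventually_sequentially by blast
  have "measure_pmf.prob (erdos_renyi n p) {E. \<not> even_degenerate {..<n} E}
      \<le> exp (- (c / 2) * real n powr (1/2 - \<alpha>))" if n: "n \<ge> max n1 16" for n
  proof -
    \<comment> \<open>The order \<open>sqrt n\<close> matches the desired exponent and keeps
      \<open>4 ^ j\<close> negligible against the exponential decay in \<open>n\<close>. The bound
      \<open>n \<ge> 16\<close> leaves room for \<open>j + 3 \<le> n\<close>.\<close>
    define j where "j = nat \<lfloor>sqrt n\<rfloor>"
    have "4 \<le> sqrt n" using n by (intro real_le_rsqrt) simp
    then have sq: "4 * sqrt n \<le> n" using mult_right_mono[of 4 "sqrt n" "sqrt n"] by simp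
    have "real j = \<lfloor>sqrt n\<rfloor>" by (simp add: j_def)
    then have j: "real j \<le> sqrt n" "sqrt n - 1 \<le> real j" by linarith+
    have j': "1 \<le> j" "j + 3 \<le> n" using j sq \<open>4 \<le> sqrt n\<close> by linarith+
    have e1: "(1 - \<delta>) ^ (n - 1) = exp (- t * (real n - 1))"
      using \<delta> j' by (simp add: pow t_def of_nat_diff mult.commute)
    have e2: "4 ^ j * \<sigma> ^ (n - 3 - j) \<le> exp (ln 4 * sqrt n - s * (real n - 3 - sqrt n))"
    proof -
      have "4 ^ j * \<sigma> ^ (n - 3 - j) = exp (ln 4 * real j - s * (real n - 3 - real j))"
        using \<sigma> j' by (simp add: pow s_def of_nat_diff exp_add[symmetric] algebra_simps)
      moreover have "ln 4 * real j \<le> ln 4 * sqrt n" "s * (real n - 3 - sqrt n) \<le> s * (real n - 3 - real j)"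
        using j pos by (intro mult_left_mono; simp)+
      then have "ln 4 * real j - s * (real n - 3 - real j) \<le> ln 4 * sqrt n - s * (real n - 3 - sqrt n)"
        by (intro diff_mono)
      ultimately show ?thesis by simp
    qed
    have e3: "\<kappa> ^ (j - 1) \<le> exp (- c * (sqrt n - 2))"
    proof -
      have "\<kappa> ^ (j - 1) = exp (- c * (real j - 1))"
        using \<kappa> j' by (simp add: pow c_def of_nat_diff mult.commute)
      moreover have "c * (sqrt n - 2) \<le> c * (real j - 1)" using j pos by (intro mult_left_mono) auto
      ultimately show ?thesis by simp
    qed
    have "measure_pmf.prob (erdos_renyi n p) {E. \<not> even_degenerate {..<n} E}
      \<le> 2 * (1 - \<delta>) ^ (n - 1) + n * (4 * 4 ^ j * \<sigma> ^ (n - 3 - j) + 2 * (\<kappa> ^ (j - 1) * D))"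
      unfolding \<sigma>_def D_def using assms j'
      by (intro prob_not_even_degenerate_le \<delta>_def \<kappa>_def \<rho>_def)
    also have "\<dots> = 2 * (1 - \<delta>) ^ (n - 1) + n * (4 * (4 ^ j * \<sigma> ^ (n - 3 - j)) + 2 * (\<kappa> ^ (j - 1) * D))"
      by (simp add: mult.assoc)
    also have "\<dots> \<le> 2 * exp (- t * (real n - 1)) + n * (4 * exp (ln 4 * sqrt n - s * (real n - 3 - sqrt n))
        + 2 * (exp (- c * (sqrt n - 2)) * D))"
      unfolding e1 using e2 e3 by (intro add_left_mono mult_left_mono add_mono mult_right_mono) (auto simp: D_def)
    also have "\<dots> \<le> exp (- (c / 2) * sqrt n)" using n n1 by simp
    also have "\<dots> \<le> exp (- (c / 2) * real n powr (1/2 - \<alpha>))"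
    proof -
      have "real n powr (1/2 - \<alpha>) \<le> real n powr (1/2)" using n assms by (intro powr_mono) auto
      then have "real n powr (1/2 - \<alpha>) \<le> sqrt n" using n by (simp add: powr_half_sqrt)
      then have "c / 2 * real n powr (1/2 - \<alpha>) \<le> c / 2 * sqrt n" using pos by (intro mult_left_mono) auto
      then show ?thesis by simp
    qed
    finally show ?thesis .
  qed
  then show ?thesis using pos by (intro exI[of _ "c / 2"] conjI exI[of _ "max n1 16"]) auto
qed

end
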